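(* Let $M$ be an $n$-dimensional space-like self-shrinker in $\mathbb{R}^{m+n}_m$ with $0\in M$, and let $z=\langle F,F\rangle$ be the pseudo-distance function, where $F$ is the position vector with respect to the origin $0\in M$. Assume that $M$ is closed with respect to the Euclidean topology. Then for any $\alpha>0$ the integral $\int_M e^{-\alpha z}\,d\mu$ is finite; in particular, $M$ has finite weighted volume, i.e. $\int_M e^{-z/4}\,d\mu<\infty$.
   Context: $\mathbb{R}^{m+n}_m$ is the pseudo-Euclidean space $\mathbb{R}^{m+n}$ with the indefinite flat metric $\langle\cdot,\cdot\rangle$ given by $ds^2=\sum_{i=1}^n (dx^i)^2-\sum_{\alpha=n+1}^{m+n}(dx^\alpha)^2$. A space-like $n$-dimensional submanifold $F:M\to\mathbb{R}^{m+n}_m$ (smooth, identified with its image; $F$ is the position vector) is one whose induced metric is positive definite (Riemannian); $d\mu$ is the volume element of the induced metric. Let $\bar\nabla$ be the flat connection of $\mathbb{R}^{m+n}_m$, and $(\cdot)^N$ the orthogonal projection onto the normal bundle. The second fundamental form is $B_{XY}=(\bar\nabla_XY)^N$ for tangent fields $X,Y$, and the mean curvature vector is $H=\sum_i B_{e_ie_i}$ for a local orthonormal tangent frame $\{e_i\}$. $M$ is a space-like self-shrinker if $H=-\frac{1}{2}F^N$ on $M$. "Closed with respect to the Euclidean topology" means that $M$ is a closed subset of $\mathbb{R}^{m+n}$ in its usual topology. The weighted volume of $M$ is its volume with respect to the weighted volume element $e^{-z/4}\,d\mu$.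
   Formalization: M is assumed connected (the usual convention for manifolds, not stated in the English); without it the claim fails, e.g. for a closed union of a space-like line through 0 and infinitely many disjoint space-like self-shrinker curves. *)

theory Defs
  imports "HOL-Analysis.Analysis"
begin

text \<open>
  The pseudo-Euclidean space with \<open>n = CARD('n)\<close> positive and \<open>m = CARD('m)\<close> negative directions is
  carried by the product type below. All topological notions on it are the Euclidean ones; the
  indefinite metric is \<open>pinner\<close>.
\<close>

type_synonym ('n, 'm) pseudo_euclidean = "(real^'n) \<times> (real^'m)"

definition pinner :: "('n::finite, 'm::finite) pseudo_euclidean \<Rightarrow> ('n, 'm) pseudo_euclidean \<Rightarrow> real"
  where "pinner v w = fst v \<bullet> fst w - snd v \<bullet> snd w"

definition pseudo_dist :: "('n::finite, 'm::finite) pseudo_euclidean \<Rightarrow> real"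
  where "pseudo_dist p = pinner p p"


subsection \<open>Smooth maps and submanifolds\<close>

primrec Ck_on :: "nat \<Rightarrow> 'a::real_normed_vector set \<Rightarrow> ('a \<Rightarrow> 'b::real_normed_vector) \<Rightarrow> bool"
  where
    "Ck_on 0 U f \<longleftrightarrow> continuous_on U f"
  | "Ck_on (Suc k) U f \<longleftrightarrow>
      (\<forall>x\<in>U. f differentiable (at x)) \<and> (\<forall>v. Ck_on k U (\<lambda>x. frechet_derivative f (at x) v))"

text \<open>Meant for open \<open>U\<close> only.\<close>

definition smooth_on :: "'a::real_normed_vector set \<Rightarrow> ('a \<Rightarrow> 'b::real_normed_vector) \<Rightarrow> bool"
  where "smooth_on U f \<longleftrightarrow> (\<forall>k. Ck_on k U f)"

definition local_param ::
    "('n::finite, 'm::finite) pseudo_euclidean set \<Rightarrow> (real^'n) set \<Rightarrow>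
     (real^'n \<Rightarrow> ('n, 'm) pseudo_euclidean) \<Rightarrow> bool"
  where "local_param M U \<phi> \<longleftrightarrow>
    open U \<and> smooth_on U \<phi> \<and> (\<forall>u\<in>U. inj (frechet_derivative \<phi> (at u))) \<and>
    openin (top_of_set M) (\<phi> ` U) \<and> (\<exists>\<psi>. homeomorphism U (\<phi> ` U) \<phi> \<psi>)"

text \<open>Smooth embedded submanifolds of dimension \<open>n = CARD('n)\<close>, without boundary.\<close>

definition submanifold :: "('n::finite, 'm::finite) pseudo_euclidean set \<Rightarrow> bool"
  where "submanifold M \<longleftrightarrow> (\<forall>p\<in>M. \<exists>U \<phi>. local_param M U \<phi> \<and> p \<in> \<phi> ` U)"

definition tangent_space ::
    "('n::finite, 'm::finite) pseudo_euclidean set \<Rightarrow> ('n, 'm) pseudo_euclidean \<Rightarrow>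
     ('n, 'm) pseudo_euclidean set"
  where "tangent_space M p =
    {v. \<exists>U \<phi> u. local_param M U \<phi> \<and> u \<in> U \<and> \<phi> u = p \<and> v \<in> range (frechet_derivative \<phi> (at u))}"

definition spacelike :: "('n::finite, 'm::finite) pseudo_euclidean set \<Rightarrow> bool"
  where "spacelike M \<longleftrightarrow> (\<forall>p\<in>M. \<forall>v\<in>tangent_space M p. v \<noteq> 0 \<longrightarrow> pinner v v > 0)"


subsection \<open>Second fundamental form and mean curvature\<close>

definition normal_space ::
    "('n::finite, 'm::finite) pseudo_euclidean set \<Rightarrow> ('n, 'm) pseudo_euclidean \<Rightarrow>
     ('n, 'm) pseudo_euclidean set"
  where "normal_space M p = {w. \<forall>v\<in>tangent_space M p. pinner v w = 0}"

text \<open>On a space-like submanifold the ambient space is the direct sum of \<open>tangent_space M p\<close> and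
  \<open>normal_space M p\<close>, so that the description is definite.\<close>

definition normal_proj ::
    "('n::finite, 'm::finite) pseudo_euclidean set \<Rightarrow> ('n, 'm) pseudo_euclidean \<Rightarrow>
     ('n, 'm) pseudo_euclidean \<Rightarrow> ('n, 'm) pseudo_euclidean"
  where "normal_proj M p X = (THE w. w \<in> normal_space M p \<and> X - w \<in> tangent_space M p)"

text \<open>Vector fields are total functions, but only their values on \<open>V\<close>, a relatively open subset
  of \<open>M\<close>, are meaningful.\<close>

definition tangent_field ::
    "('n::finite, 'm::finite) pseudo_euclidean set \<Rightarrow> ('n, 'm) pseudo_euclidean set \<Rightarrow>
     (('n, 'm) pseudo_euclidean \<Rightarrow> ('n, 'm) pseudo_euclidean) \<Rightarrow> bool"
  where "tangent_field M V Y \<longleftrightarrow>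
    (\<forall>p\<in>V. Y p \<in> tangent_space M p) \<and>
    (\<forall>U \<phi>. local_param M U \<phi> \<and> \<phi> ` U \<subseteq> V \<longrightarrow> smooth_on U (Y \<circ> \<phi>))"

text \<open>The flat connection is the directional derivative. The derivative of \<open>Y\<close> at \<open>p\<close> within \<open>M\<close> is
  not unique as a linear map on the ambient space, but its values on tangent vectors of \<open>M\<close> are,
  and it is only applied to those.\<close>

definition second_fundamental_form ::
    "('n::finite, 'm::finite) pseudo_euclidean set \<Rightarrow>
     (('n, 'm) pseudo_euclidean \<Rightarrow> ('n, 'm) pseudo_euclidean) \<Rightarrow>
     (('n, 'm) pseudo_euclidean \<Rightarrow> ('n, 'm) pseudo_euclidean) \<Rightarrow>
     ('n, 'm) pseudo_euclidean \<Rightarrow> ('n, 'm) pseudo_euclidean"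
  where "second_fundamental_form M X Y p =
    normal_proj M p (frechet_derivative Y (at p within M) (X p))"

definition orthonormal_frame ::
    "('n::finite, 'm::finite) pseudo_euclidean set \<Rightarrow> ('n, 'm) pseudo_euclidean set \<Rightarrow>
     ('n \<Rightarrow> ('n, 'm) pseudo_euclidean \<Rightarrow> ('n, 'm) pseudo_euclidean) \<Rightarrow> bool"
  where "orthonormal_frame M V e \<longleftrightarrow>
    openin (top_of_set M) V \<and> (\<forall>i. tangent_field M V (e i)) \<and>
    (\<forall>p\<in>V. \<forall>i j. pinner (e i p) (e j p) = (if i = j then 1 else 0))"

text \<open>The trace does not depend on the local orthonormal frame.\<close>

definition mean_curvature ::
    "('n::finite, 'm::finite) pseudo_euclidean set \<Rightarrow> ('n, 'm) pseudo_euclidean \<Rightarrow>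
     ('n, 'm) pseudo_euclidean"
  where "mean_curvature M p =
    (THE h. \<exists>V e. orthonormal_frame M V e \<and> p \<in> V \<and>
       h = (\<Sum>i\<in>UNIV. second_fundamental_form M (e i) (e i) p))"

definition spacelike_self_shrinker :: "('n::finite, 'm::finite) pseudo_euclidean set \<Rightarrow> bool"
  where "spacelike_self_shrinker M \<longleftrightarrow>
    submanifold M \<and> spacelike M \<and>
    (\<forall>p\<in>M. mean_curvature M p = - (1/2) *\<^sub>R normal_proj M p p)"


subsection \<open>Induced volume\<close>

definition induced_metric ::
    "(real^'n::finite \<Rightarrow> ('n, 'm::finite) pseudo_euclidean) \<Rightarrow> real^'n \<Rightarrow> real^'n^'n"
  where "induced_metric \<phi> u =
    (\<chi> i j. pinner (frechet_derivative \<phi> (at u) (axis i 1)) (frechet_derivative \<phi> (at u) (axis j 1)))"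

text \<open>The measure \<open>sqrt (det g) du\<close> on the patch \<open>\<phi> ` U\<close>, as a Borel measure on the ambient space.\<close>

definition patch_measure ::
    "(real^'n::finite) set \<Rightarrow> (real^'n \<Rightarrow> ('n, 'm::finite) pseudo_euclidean) \<Rightarrow>
     ('n, 'm) pseudo_euclidean measure"
  where "patch_measure U \<phi> =
    distr (density (restrict_space lborel U) (\<lambda>u. ennreal (sqrt (det (induced_metric \<phi> u))))) borel \<phi>"

text \<open>
  By the change of variables formula the patch measures agree on overlaps, so they are the
  restrictions to the patches of one Borel measure, the Riemannian volume \<open>d\<mu>\<close> of \<open>M\<close>. As countably
  many patches cover \<open>M\<close>, this measure is the supremum of the patch measures in the complete
  lattice of measures (least upper bound, not pointwise supremum). It is concentrated on \<open>M\<close>.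
\<close>

definition volume_measure ::
    "('n::finite, 'm::finite) pseudo_euclidean set \<Rightarrow> ('n, 'm) pseudo_euclidean measure"
  where "volume_measure M = (SUP (U, \<phi>) \<in> {(U, \<phi>). local_param M U \<phi>}. patch_measure U \<phi>)"

definition weighted_volume :: "('n::finite, 'm::finite) pseudo_euclidean set \<Rightarrow> ennreal"
  where "weighted_volume M =
    emeasure (density (volume_measure M) (\<lambda>p. ennreal (exp (- pseudo_dist p / 4)))) M"

end

theory Submission
  imports Defs
begin

text \<open>
  The projection of \<open>M\<close> to the space-like factor is a local diffeomorphism, and \<open>M\<close> is locally the graph of
  a map whose derivative strictly decreases norms. As \<open>M\<close> is closed, lifts of segments extend to
  their endpoints, so the connected \<open>M\<close> is the graph of a map \<open>u\<close> on the whole space-like factor, with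
  \<open>norm (u y - u x) < norm (y - x)\<close> for \<open>x \<noteq> y\<close> and \<open>u 0 = 0\<close>. Therefore \<open>norm x - norm (u x)\<close> is
  nondecreasing along rays and bounded below by some \<open>c > 0\<close> outside the unit ball, and
  \<open>z = (norm x - norm (u x)) * (norm x + norm (u x))\<close> grows at least like \<open>c * norm x\<close>. The
  volume element of \<open>M\<close> is at most that of the space-like factor, so the integral is dominated by that
  of \<open>exp (- \<alpha> * c * norm x)\<close>.
\<close>


subsection \<open>Change of variables for arbitrary finite index types\<close>

text \<open>The change of variables theorem of the library is stated for well-ordered index types only; \<open>'a indexed\<close>
  is a copy of the finite type \<open>'a\<close> that carries such an order.\<close>

typedef 'a indexed = "UNIV :: 'a set" morphisms of_indexed to_indexed
  by simp

lemma bij_of_indexed: "bij of_indexed"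
  using of_indexed_inject of_indexed_cases by (auto simp: bij_def inj_def surj_def) (metis to_indexed_inverse UNIV_I)

lemma bij_to_indexed: "bij to_indexed"
  by (metis bijI' to_indexed_inject to_indexed_cases UNIV_I)

instance indexed :: (finite) finite
  by standard (metis bij_to_indexed bij_is_surj finite finite_imageI)

text \<open>Pulls the well-order of \<open>nat\<close> back to the finite type. Which injection is
  chosen is immaterial: the order serves only to meet the sort constraint
  \<open>wellorder\<close>.\<close>

definition index_rank :: "'a::finite \<Rightarrow> nat"
  where "index_rank = (SOME r. inj r)"

lemma inj_index_rank: "inj (index_rank :: 'a::finite \<Rightarrow> nat)"
proof -
  have "\<exists>r :: 'a \<Rightarrow> nat. inj r"
    using finite_imp_inj_to_nat_seg[of "UNIV :: 'a set"] by auto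
  then show ?thesis
    unfolding index_rank_def by (rule someI_ex)
qed

instantiation indexed :: (finite) wellorder
begin

definition less_eq_indexed :: "'a indexed \<Rightarrow> 'a indexed \<Rightarrow> bool"
  where "x \<le> y \<longleftrightarrow> index_rank (of_indexed x) \<le> index_rank (of_indexed y)"

definition less_indexed :: "'a indexed \<Rightarrow> 'a indexed \<Rightarrow> bool"
  where "x < y \<longleftrightarrow> index_rank (of_indexed x) < index_rank (of_indexed y)"

instance
proof
  fix x y :: "'a indexed"
  assume "x \<le> y" "y \<le> x"
  then have "index_rank (of_indexed x) = index_rank (of_indexed y)"
    unfolding less_eq_indexed_def by (rule order_antisym)
  then have "of_indexed x = of_indexed y"
    by (rule injD[OF inj_index_rank])
  then show "x = y"
    unfolding of_indexed_inject .
next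
  fix P :: "'a indexed \<Rightarrow> bool" and a
  assume step: "\<And>x. (\<And>y. y < x \<Longrightarrow> P y) \<Longrightarrow> P x"
  show "P a"
  proof (induction a rule: measure_induct_rule[where f = "\<lambda>x. index_rank (of_indexed x)"])
    case (less x)
    then show ?case
      unfolding less_indexed_def[symmetric] by (rule step)
  qed
qed (auto simp: less_eq_indexed_def less_indexed_def)

end

text \<open>Conjugation with \<open>f\<close> is a sign-preserving bijection between the
  permutations of the two index types, so the Leibniz sums agree term by term.\<close>

lemma det_reindex:
  fixes A :: "'c::comm_ring_1^'a^'a" and f :: "'b::finite \<Rightarrow> 'a::finite"
  assumes "bij f"
  shows "det (\<chi> i j. A $ f i $ f j) = det A"
proof -
  let ?h = "\<lambda>p. \<lambda>x. f (p (inv f x))"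
  have inv: "inv f (f x) = x" "f (inv f y) = y" for x y
    using assms by (auto simp: bij_is_inj bij_is_surj surj_f_inv_f)
  have bij: "bij_betw ?h {p. p permutes UNIV} {p. p permutes UNIV}"
  proof (rule bij_betw_byWitness[where f' = "\<lambda>q x. inv f (q (f x))"])
    have "?h p permutes UNIV" if "p permutes UNIV" for p
      using permutes_bij_inv_into[OF that, of f UNIV] assms by simp
    then show "?h ` {p. p permutes UNIV} \<subseteq> {p. p permutes UNIV}"
      by auto
    have "(\<lambda>x. inv f (q (f x))) permutes UNIV" if "q permutes UNIV" for q
      using permutes_bij_inv_into[OF that, of "inv f" UNIV] assms 
      by (simp add: bij_imp_bij_inv inv_inv_eq)
    then show "(\<lambda>q x. inv f (q (f x))) ` {p. p permutes UNIV} \<subseteq> {p. p permutes UNIV}"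
      by auto
  qed (auto simp: inv)
  have sign: "sign (?h p) = sign p" if "p permutes UNIV" for p
  proof -
    \<comment> \<open>This locale carries a permutation along a bijection of finite index types; its
      fact \<open>sign_p'\<close> says that the sign is unchanged.\<close>
    interpret permutes_bij_finite p UNIV UNIV f "inv f" "\<lambda>x. if x \<in> UNIV then f (p (inv f x)) else x"
      by unfold_locales (use that assms inv in auto)
    show ?thesis
      using sign_p' by simp
  qed
  have prod: "(\<Prod>i\<in>UNIV. A $ i $ ?h p i) = (\<Prod>i\<in>UNIV. A $ f i $ f (p i))" for p
    by (rule prod.reindex_bij_betw[OF assms, symmetric, THEN trans]) (simp add: inv)
  have "det A = (\<Sum>p | p permutes UNIV. of_int (sign (?h p)) * (\<Prod>i\<in>UNIV. A $ i $ ?h p i))"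
    unfolding det_def by (rule sum.reindex_bij_betw[OF bij, symmetric])
  also have "\<dots> = det (\<chi> i j. A $ f i $ f j)"
    unfolding det_def by (auto intro!: sum.cong simp: prod sign)
  finally show ?thesis ..
qed

text \<open>A renaming of coordinates sends boxes to boxes with permuted side lengths, and Lebesgue
  measure is determined by its values on boxes.\<close>

lemma lborel_distr_reindex:
  fixes f :: "'b::finite \<Rightarrow> 'a::finite"
  assumes f: "bij f"
  shows "distr lborel borel (\<lambda>x :: real^'a. \<chi> i. x $ f i) = lborel"
proof (rule lborel_eqI[symmetric])
  let ?P = "\<lambda>x :: real^'a. \<chi> i. x $ f i"
  have P: "?P \<in> borel_measurable borel"
    by (intro borel_measurable_continuous_onI continuous_intros)
  fix l u :: "real^'b"
  assume le: "\<And>b. b \<in> Basis \<Longrightarrow> l \<bullet> b \<le> u \<bullet> b"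
  have inv: "inv f (f x) = x" "f (inv f y) = y" for x y
    using assms by (auto simp: bij_is_inj bij_is_surj surj_f_inv_f)
  let ?Q = "\<lambda>x :: real^'b. \<chi> i. x $ inv f i"
  have eq: "?P -` box l u = box (?Q l) (?Q u)"
    unfolding set_eq_iff vimage_eq mem_box_cart by (simp) (metis inv)
  have le': "l $ i \<le> u $ i" for i
    using le[of "axis i 1"] by (simp add: inner_axis)
  have prod: "(\<Prod>b\<in>Basis. (v::real^'c) \<bullet> b) = (\<Prod>i\<in>UNIV. v $ i)" for v
    unfolding Basis_vec_def
    by (simp add: UNION_singleton_eq_range inner_axis axis_eq_axis inj_on_def prod.reindex o_def
        flip: image_image)
  have "emeasure lborel (box (?Q l) (?Q u)) = ennreal (\<Prod>b\<in>Basis. (?Q u - ?Q l) \<bullet> b)"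
    using le' by (subst emeasure_lborel_box) (auto simp: Basis_vec_def inner_axis)
  also have "(\<Prod>b\<in>Basis. (?Q u - ?Q l) \<bullet> b) = (\<Prod>b\<in>Basis. (u - l) \<bullet> b)"
    unfolding prod by (rule prod.reindex_bij_betw[OF f, symmetric, THEN trans]) (simp add: inv)
  finally show "emeasure (distr lborel borel ?P) (box l u) = (\<Prod>b\<in>Basis. (u - l) \<bullet> b)"
    using P by (simp add: emeasure_distr eq)
qed simp

text \<open>If the image has finite measure, the change of variables theorem gives equality;
  otherwise the bound is trivial. The inequality is what the later volume comparison calls
  for.\<close>

lemma nn_integral_abs_det_le_wellorder:
  fixes f :: "real^'n::{finite,wellorder} \<Rightarrow> real^'n::_"
  assumes S: "S \<in> sets borel" and fS: "f ` S \<in> sets borel"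
    and der: "\<And>x. x \<in> S \<Longrightarrow> (f has_derivative f' x) (at x within S)"
    and inj: "inj_on f S"
  shows "(\<integral>\<^sup>+x\<in>S. ennreal \<bar>det (matrix (f' x))\<bar> \<partial>lborel) \<le> emeasure lborel (f ` S)"
proof (cases "emeasure lborel (f ` S) = \<infinity>")
  case False
  have S': "S \<in> sets lebesgue"
    using S by simp
  have fin: "f ` S \<in> lmeasurable"
    using False fS by (auto simp: fmeasurable_def less_top)
  then have "((\<lambda>x. \<bar>det (matrix (f' x))\<bar>) has_integral measure lebesgue (f ` S)) S"
    using has_measure_differentiable_image[OF S' der inj] by blast
  from nn_integral_has_integral_lebesgue[OF _ this]
  have "(\<integral>\<^sup>+x. ennreal (indicator S x * \<bar>det (matrix (f' x))\<bar>) \<partial>lborel)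
      = ennreal (measure lebesgue (f ` S))"
    by simp
  also have "ennreal (measure lebesgue (f ` S)) = emeasure lborel (f ` S)"
    using False fS by (simp add: emeasure_eq_ennreal_measure)
  finally show ?thesis
    by (simp add: ennreal_mult' ennreal_indicator mult.commute)
qed simp


text \<open>Conjugates \<open>f\<close> with the mutually inverse relabellings \<open>?P\<close> and
  \<open>?Q\<close>, under which Jacobian determinants and Lebesgue measure are invariant. The
  hypothesis \<open>meas\<close> permits the integral to be transported through
  \<open>distr\<close>.\<close>

lemma nn_integral_abs_det_le:
  fixes f :: "real^'n \<Rightarrow> real^'n"
  assumes S: "S \<in> sets borel" and fS: "f ` S \<in> sets borel"
    and der: "\<And>x. x \<in> S \<Longrightarrow> (f has_derivative f' x) (at x within S)"
    and inj: "inj_on f S"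
    and meas: "(\<lambda>x. indicator S x * det (matrix (f' x))) \<in> borel_measurable borel"
  shows "(\<integral>\<^sup>+x\<in>S. ennreal \<bar>det (matrix (f' x))\<bar> \<partial>lborel) \<le> emeasure lborel (f ` S)"
proof -
  let ?P = "\<lambda>x :: real^'n. (\<chi> i. x $ of_indexed i) :: real^'n indexed"
  let ?Q = "\<lambda>y :: real^'n indexed. (\<chi> i. y $ to_indexed i) :: real^'n"
  let ?F = "\<lambda>y. ?P (f (?Q y))" and ?F' = "\<lambda>y v. ?P (f' (?Q y) (?Q v))"
  have PQ: "?P (?Q y) = y" and QP: "?Q (?P x) = x" for x y
    by (simp_all add: vec_eq_iff of_indexed_inverse to_indexed_inverse)
  have linP: "bounded_linear ?P" and linQ: "bounded_linear ?Q"
    by (simp_all add: linear_conv_bounded_linear[symmetric] linear_iff vec_eq_iff)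
  have Q: "?Q \<in> borel_measurable borel"
    by (intro borel_measurable_continuous_onI continuous_intros)
  have lborel: "lborel = distr lborel borel ?Q"
    by (rule lborel_distr_reindex[OF bij_to_indexed, symmetric])
  \<comment> \<open>Images under \<open>?P\<close> are rewritten as preimages under its inverse,
    which makes their measurability immediate.\<close>
  have PS: "?P ` T = ?Q -` T" for T
  proof (intro subset_antisym subsetI)
    fix y assume "y \<in> ?Q -` T"
    then have "?Q y \<in> T"
      by simp
    then have "?P (?Q y) \<in> ?P ` T"
      by (rule imageI)
    then show "y \<in> ?P ` T"
      unfolding PQ .
  qed (auto simp: to_indexed_inverse)
  have sets: "?P ` T \<in> sets borel" if "T \<in> sets borel" for T
    using measurable_sets[OF Q that] by (simp add: PS)
  have F: "?F ` ?P ` S = ?P ` f ` S"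
    by (simp add: image_image to_indexed_inverse)
  have der': "(?F has_derivative ?F' y) (at y within ?P ` S)" if "y \<in> ?P ` S" for y
  proof -
    have "?Q ` ?P ` S = S"
      by (simp add: image_image to_indexed_inverse)
    then have "(f has_derivative f' (?Q y)) (at (?Q y) within ?Q ` ?P ` S)"
      using der that by (auto simp: QP)
    from diff_chain_within[OF bounded_linear_imp_has_derivative[OF linQ] this]
    have "(f \<circ> ?Q has_derivative f' (?Q y) \<circ> ?Q) (at y within ?P ` S)" .
    from bounded_linear.has_derivative[OF linP this] show ?thesis
      by (simp add: o_def)
  qed
  have inj': "inj_on ?F (?P ` S)"
  proof (rule inj_onI)
    fix y z assume y: "y \<in> ?P ` S" and z: "z \<in> ?P ` S" and eq: "?F y = ?F z"
    have "?Q (?P (f (?Q y))) = ?Q (?P (f (?Q z)))"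
      unfolding eq ..
    then have "f (?Q y) = f (?Q z)"
      unfolding QP .
    moreover have "?Q y \<in> S" "?Q z \<in> S"
      using y z by (simp_all add: PS)
    ultimately have "?Q y = ?Q z"
      by (rule inj_onD[OF inj])
    then have "?P (?Q y) = ?P (?Q z)"
      by (rule arg_cong)
    then show "y = z"
      unfolding PQ .
  qed
  have FS: "?F ` ?P ` S \<in> sets borel"
    unfolding F by (rule sets[OF fS])
  have le: "(\<integral>\<^sup>+y\<in>?P ` S. ennreal \<bar>det (matrix (?F' y))\<bar> \<partial>lborel)
      \<le> emeasure lborel (?P ` f ` S)"
    unfolding F[symmetric] by (rule nn_integral_abs_det_le_wellorder[OF sets[OF S] FS der' inj'])
  have "?Q (axis j 1) = axis (of_indexed j) 1" for j
    by (auto simp: vec_eq_iff axis_def of_indexed_inverse to_indexed_inverse)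
  then have "matrix (?F' y)
      = (\<chi> i j. matrix (f' (?Q y)) $ of_indexed i $ of_indexed j)" for y
    by (simp add: matrix_def vec_eq_iff)
  then have det: "det (matrix (?F' y)) = det (matrix (f' (?Q y)))" for y
    using det_reindex[OF bij_of_indexed] by metis
  have ind: "indicator S (?Q y) = (indicator (?P ` S) y :: ennreal)" for y
    unfolding PS by (simp add: indicator_def)
  have "(\<lambda>x. ennreal \<bar>indicator S x * det (matrix (f' x))\<bar>) \<in> borel_measurable borel"
    using meas by measurable
  then have meas': "(\<lambda>x. ennreal \<bar>det (matrix (f' x))\<bar> * indicator S x) \<in> borel_measurable borel"
    by (rule back_subst[where P = "\<lambda>h. h \<in> borel_measurable borel"]) (auto simp: indicator_def)
  have "(\<integral>\<^sup>+x\<in>S. ennreal \<bar>det (matrix (f' x))\<bar> \<partial>lborel)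
      = (\<integral>\<^sup>+y\<in>?P ` S. ennreal \<bar>det (matrix (?F' y))\<bar> \<partial>lborel)"
    by (subst lborel, subst nn_integral_distr) (use Q meas' in \<open>simp_all add: det ind\<close>)
  also note le
  also have "emeasure lborel (?P ` f ` S) = emeasure lborel (f ` S)"
    by (subst lborel, subst emeasure_distr) (use Q fS in \<open>simp_all add: PS\<close>)
  finally show ?thesis .
qed


subsection \<open>A determinant inequality\<close>

text \<open>The inverse \<open>B\<close> does not increase norms and so maps the unit ball into
  itself; comparing volumes gives \<open>\<bar>det B\<bar> \<le> 1\<close>.\<close>

lemma abs_det_ge_1_of_expanding:
  fixes A :: "real^'n^'n"
  assumes A: "\<And>v. norm v \<le> norm (A *v v)"
  shows "1 \<le> \<bar>det A\<bar>"
proof -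
  have "\<forall>v. A *v v = 0 \<longrightarrow> v = 0"
    using A by (metis norm_le_zero_iff norm_zero)
  then obtain B where BA: "B ** A = mat 1"
    using matrix_left_invertible_ker[of A] by auto
  then have AB: "A ** B = mat 1"
    using matrix_left_right_inverse by blast
  have B: "norm (B *v v) \<le> norm v" for v
    using A[of "B *v v"] AB by (simp add: matrix_vector_mul_assoc)
  have inj: "inj ((*v) B)"
    by (metis AB injI matrix_vector_mul_assoc matrix_vector_mul_lid)
  let ?S = "ball 0 1 :: (real^'n) set"
  \<comment> \<open>Openness supplies the Borel measurability of the image that the volume bound
    requires.\<close>
  have open_image: "open ((*v) B ` ?S)"
    by (rule invariance_of_domain) (auto intro: inj_on_subset[OF inj] matrix_vector_mult_linear_continuous_on)
  have [measurable]: "?S \<in> sets borel"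
    by simp
  have "(\<lambda>x. indicator ?S x * det (matrix ((*v) B))) \<in> borel_measurable borel"
    by measurable
  then have "(\<integral>\<^sup>+x\<in>?S. ennreal \<bar>det (matrix ((*v) B))\<bar> \<partial>lborel) \<le> emeasure lborel ((*v) B ` ?S)"
    by (intro nn_integral_abs_det_le)
      (use open_image inj in \<open>auto intro: inj_on_subset has_derivative_at_withinI bounded_linear_imp_has_derivative\<close>)
  also have "\<dots> \<le> emeasure lborel ?S"
    by (rule emeasure_mono) (use B le_less_trans in \<open>auto, blast\<close>)
  finally have "ennreal \<bar>det B\<bar> * emeasure lborel ?S \<le> emeasure lborel ?S"
    by (simp add: nn_integral_cmult_indicator)
  then have le: "\<bar>det B\<bar> * unit_ball_vol (real CARD('n)) \<le> unit_ball_vol (real CARD('n))"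
    by (simp add: emeasure_ball flip: ennreal_mult')
  have "unit_ball_vol (real CARD('n)) > 0"
    by simp
  with le have "\<bar>det B\<bar> \<le> 1"
    by simp
  moreover have "\<bar>det A\<bar> * \<bar>det B\<bar> = 1"
    using arg_cong[OF AB, of det] by (simp add: det_mul flip: abs_mult)
  ultimately show ?thesis
    by (metis abs_ge_zero mult.right_neutral mult_left_mono)
qed

text \<open>The columns of \<open>E\<close> are a basis orthonormal for the inner product given by
  \<open>G\<close>. An orthonormal set of maximal size must span, since otherwise one Gram-Schmidt
  step would enlarge it.\<close>

lemma exists_orthonormal_basis_matrix:
  fixes G :: "real^'n^'n"
  assumes sym: "transpose G = G" and pos: "\<And>v. v \<noteq> 0 \<Longrightarrow> 0 < v \<bullet> (G *v v)"
  obtains E :: "real^'n^'n" where "transpose E ** G ** E = mat 1"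
proof -
  define b where "b x y = x \<bullet> (G *v y)" for x y
  have b_sym: "b x y = b y x" for x y
    by (metis b_def dot_lmul_matrix inner_commute sym transpose_matrix_vector)
  have b_lin [simp]: "b x (y + z) = b x y + b x z" "b x (y - z) = b x y - b x z" "b x (c *\<^sub>R y) = c * b x y"
      "b x (sum h X) = (\<Sum>i\<in>X. b x (h i))" for x y z c and h :: "real^'n \<Rightarrow> real^'n" and X
    by (simp_all add: b_def algebra_simps matrix_vector_mult_diff_distrib matrix_vector_mult_scaleR
        linear_sum[OF matrix_vector_mul_linear] inner_sum_right)
  have b_lin' [simp]: "b (x + y) z = b x z + b y z" "b (x - y) z = b x z - b y z" "b (c *\<^sub>R x) z = c * b x z"
    for x y z c
    by (simp_all add: b_sym[of _ z])
  define orth where "orth X \<longleftrightarrow> finite X \<and> (\<forall>x\<in>X. \<forall>y\<in>X. b x y = (if x = y then 1 else 0))" for X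
  have indep: "independent X" if "orth X" for X
  proof (rule independent_if_scalars_zero)
    show "finite X"
      using that by (simp add: orth_def)
    fix c x assume 0: "(\<Sum>x\<in>X. c x *\<^sub>R x) = 0" and x: "x \<in> X"
    have "0 = b x (\<Sum>x\<in>X. c x *\<^sub>R x)"
      unfolding 0 by (simp add: b_def)
    also have "\<dots> = (\<Sum>y\<in>X. c y * (if x = y then 1 else 0))"
      using that x by (simp add: orth_def)
    also have "\<dots> = c x"
      using that x by (simp add: orth_def if_distrib[of "(*) _"] cong: if_cong)
    finally show "c x = 0" ..
  qed
  have "\<exists>X. orth X \<and> (\<forall>Y. orth Y \<longrightarrow> card Y \<le> card X)"
  \<comment> \<open>Orthonormal sets are independent, so the dimension bounds their size and a
    largest one exists.\<close>
  proof (rule ex_has_greatest_nat[where b = "Suc CARD('n)"])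
    show "orth {}"
      by (simp add: orth_def)
    show "\<forall>Y. orth Y \<longrightarrow> card Y < Suc CARD('n)"
      using indep independent_bound by (fastforce simp: less_Suc_eq_le)
  qed
  then obtain X where X: "orth X" and max: "\<And>Y. orth Y \<Longrightarrow> card Y \<le> card X"
    by auto
  have fin: "finite X"
    using X by (simp add: orth_def)
  have span: "span X = UNIV"
  proof (rule ccontr)
    assume "span X \<noteq> UNIV"
    then obtain v where v: "v \<notin> span X"
      by auto
    define w where "w = v - (\<Sum>x\<in>X. b x v *\<^sub>R x)"
    have "w \<noteq> 0"
      using v span_sum[of X "\<lambda>x. b x v *\<^sub>R x" X] by (auto simp: w_def span_scale span_base)
    then have bw: "0 < b w w"
      using pos by (simp add: b_def)
    have bxw: "b x w = 0" if "x \<in> X" for x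
    proof -
      have "(\<Sum>y\<in>X. b y v * b x y) = (\<Sum>y\<in>X. b y v * (if x = y then 1 else 0))"
        using X that by (simp add: orth_def)
      also have "\<dots> = b x v"
        using that fin by (simp add: if_distrib[of "(*) _"] cong: if_cong)
      finally show ?thesis
        by (simp add: w_def)
    qed
    define w' where "w' = (1 / sqrt (b w w)) *\<^sub>R w"
    have w': "b w' w' = 1"
      using bw by (simp add: w'_def)
    have xw': "b x w' = 0" "b w' x = 0" if "x \<in> X" for x
      using bxw[OF that] b_sym[of w x] by (simp_all add: w'_def)
    have notin: "w' \<notin> X"
      using w' xw' by force
    have "orth (insert w' X)"
      using X xw' w' notin unfolding orth_def by (metis finite_insert insert_iff)
    then show False
      using max[of "insert w' X"] fin notin by simp
  qed
  have "card X = CARD('n)"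
    using dim_eq_card[of X UNIV] indep[OF X] span by simp
  then obtain e where e: "bij_betw e (UNIV :: 'n set) X"
    using finite_same_card_bij[of "UNIV :: 'n set" X] fin by auto
  define E :: "real^'n^'n" where "E = (\<chi> i j. e j $ i)"
  have col: "E *v axis j 1 = e j" for j
    by (simp add: E_def vec_eq_iff matrix_vector_mult_basis column_def)
  have "(transpose E ** G ** E) $ i $ j = (mat 1 :: real^'n^'n) $ i $ j" for i j
  proof -
    have "(transpose E ** G ** E) $ i $ j = axis i 1 \<bullet> ((transpose E ** G ** E) *v axis j 1)"
      by (simp add: inner_axis' matrix_vector_mult_basis column_def)
    also have "\<dots> = axis i 1 \<bullet> (transpose E *v (G *v e j))"
      by (simp add: col flip: matrix_vector_mul_assoc)
    also have "\<dots> = b (e i) (e j)"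
      unfolding b_def by (metis col dot_lmul_matrix transpose_matrix_vector transpose_transpose)
    also have "\<dots> = (if i = j then 1 else 0)"
      using X e by (auto simp: orth_def bij_betw_def inj_on_def)
    finally show ?thesis
      by (simp add: mat_def)
  qed
  then have "transpose E ** G ** E = mat 1"
    by (simp add: vec_eq_iff)
  then show ?thesis ..
qed

text \<open>In a basis \<open>E\<close> orthonormal for \<open>G\<close> the hypothesis says that
  \<open>A ** E\<close> does not decrease norms, so
  \<open>\<bar>det A\<bar> * \<bar>det E\<bar>\<close> is at least 1, whereas
  \<open>det G * (det E)\<^sup>2 = 1\<close>.\<close>

lemma sqrt_det_le_abs_det:
  fixes A G :: "real^'n^'n"
  assumes sym: "transpose G = G" and pos: "\<And>v. v \<noteq> 0 \<Longrightarrow> 0 < v \<bullet> (G *v v)"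
    and le: "\<And>v. v \<bullet> (G *v v) \<le> (norm (A *v v))\<^sup>2"
  shows "sqrt (det G) \<le> \<bar>det A\<bar>"
proof -
  obtain E :: "real^'n^'n" where E: "transpose E ** G ** E = mat 1"
    using exists_orthonormal_basis_matrix[OF sym pos] by blast
  have "norm v \<le> norm ((A ** E) *v v)" for v
  proof -
    have "(norm v)\<^sup>2 = v \<bullet> ((transpose E ** G ** E) *v v)"
      by (simp add: E power2_norm_eq_inner)
    also have "\<dots> = (E *v v) \<bullet> (G *v (E *v v))"
      by (metis dot_lmul_matrix matrix_vector_mul_assoc transpose_matrix_vector transpose_transpose)
    also have "\<dots> \<le> (norm ((A ** E) *v v))\<^sup>2"
      using le[of "E *v v"] by (simp add: matrix_vector_mul_assoc)
    finally show ?thesis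
      by (simp add: power2_le_iff_abs_le)
  qed
  then have 1: "1 \<le> \<bar>det A\<bar> * \<bar>det E\<bar>"
    using abs_det_ge_1_of_expanding[of "A ** E"] by (simp add: det_mul abs_mult)
  have 2: "det G * (det E)\<^sup>2 = 1"
    using arg_cong[OF E, of det] by (simp add: det_mul power2_eq_square mult_ac)
  have "det G * (det E)\<^sup>2 \<le> (det A)\<^sup>2 * (det E)\<^sup>2"
    using power_mono[OF 1, of 2] 2 by (simp add: power_mult_distrib)
  moreover have "(det E)\<^sup>2 > 0"
    using 2 by auto
  ultimately have "det G \<le> (det A)\<^sup>2"
    by simp
  then show ?thesis
    by (metis real_sqrt_abs real_sqrt_le_mono)
qed


subsection \<open>Global graphs\<close>

text \<open>The strict bound on \<open>D\<close> expresses that the tangent planes of the graph are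
  space-like. It is pointwise, without a uniform constant below 1.\<close>

definition contracting_section ::
    "('a::euclidean_space \<times> 'b::euclidean_space) set \<Rightarrow> 'a set \<Rightarrow> ('a \<Rightarrow> 'b) \<Rightarrow> bool"
  where "contracting_section M V \<sigma> \<longleftrightarrow>
    (\<forall>x\<in>V. (x, \<sigma> x) \<in> M \<and> (\<exists>D. (\<sigma> has_derivative D) (at x) \<and> (\<forall>v. v \<noteq> 0 \<longrightarrow> norm (D v) < norm v)))"

text \<open>Only the part of \<open>M\<close> inside \<open>W\<close> has to lie on the graph of
  \<open>\<tau>\<close>; several sheets of \<open>M\<close> over the same \<open>V\<close> are still
  possible.\<close>

definition locally_contracting_graph :: "('a::euclidean_space \<times> 'b::euclidean_space) set \<Rightarrow> bool"
  where "locally_contracting_graph M \<longleftrightarrow>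
    (\<forall>p\<in>M. \<exists>V W \<tau>. open V \<and> fst p \<in> V \<and> open W \<and> p \<in> W \<and> contracting_section M V \<tau> \<and>
      (\<forall>q\<in>M \<inter> W. fst q \<in> V \<and> snd q = \<tau> (fst q)))"

lemma locally_contracting_graphE:
  assumes "locally_contracting_graph M" "p \<in> M"
  obtains V W \<tau> where "open V" "fst p \<in> V" "open W" "p \<in> W" "contracting_section M V \<tau>"
    "\<And>q. q \<in> M \<inter> W \<Longrightarrow> fst q \<in> V \<and> snd q = \<tau> (fst q)"
proof -
  have "\<exists>V W \<tau>. open V \<and> fst p \<in> V \<and> open W \<and> p \<in> W \<and> contracting_section M V \<tau> \<and>
      (\<forall>q\<in>M \<inter> W. fst q \<in> V \<and> snd q = \<tau> (fst q))"
    using assms unfolding locally_contracting_graph_def by (rule bspec)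
  then show ?thesis
    using that by blast
qed

section \<open>Contracting sections: mean value bound and uniqueness\<close>

lemma contracting_section_subset:
  "contracting_section M V \<sigma> \<Longrightarrow> V' \<subseteq> V \<Longrightarrow> contracting_section M V' \<sigma>"
  by (auto simp: contracting_section_def)

lemma contracting_section_cong:
  assumes "contracting_section M V \<sigma>" "open V" "\<And>x. x \<in> V \<Longrightarrow> \<sigma>' x = \<sigma> x"
  shows "contracting_section M V \<sigma>'"
  unfolding contracting_section_def
proof (intro ballI conjI)
  fix x assume x: "x \<in> V"
  then obtain D where D: "(\<sigma> has_derivative D) (at x)" "\<forall>v. v \<noteq> 0 \<longrightarrow> norm (D v) < norm v"
    using assms(1) by (auto simp: contracting_section_def)
  have "(\<sigma>' has_derivative D) (at x)"
    using D(1) by (rule has_derivative_transform_within_open) (use assms x in auto)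
  with D show "\<exists>D. (\<sigma>' has_derivative D) (at x) \<and> (\<forall>v. v \<noteq> 0 \<longrightarrow> norm (D v) < norm v)"
    by blast
  show "(x, \<sigma>' x) \<in> M"
    using assms x by (auto simp: contracting_section_def)
qed

lemma contracting_section_isCont: "contracting_section M V \<sigma> \<Longrightarrow> x \<in> V \<Longrightarrow> isCont \<sigma> x"
  unfolding contracting_section_def using has_derivative_continuous by blast

lemma contracting_section_continuous_on: "contracting_section M V \<sigma> \<Longrightarrow> continuous_on V \<sigma>"
  by (simp add: contracting_section_isCont continuous_at_imp_continuous_on)

text \<open>Mean value inequality along the segment from \<open>x\<close> to \<open>y\<close>. The
  form used bounds the increment by the derivative at a single point, so strictness
  survives.\<close>

lemma contracting_section_norm_less:
  assumes \<sigma>: "contracting_section M V \<sigma>" and V: "convex V" and xy: "x \<in> V" "y \<in> V" "x \<noteq> y"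
  shows "norm (\<sigma> y - \<sigma> x) < norm (y - x)"
proof -
  obtain D where D: "\<And>z. z \<in> V \<Longrightarrow> (\<sigma> has_derivative D z) (at z) \<and> (\<forall>v. v \<noteq> 0 \<longrightarrow> norm (D z v) < norm v)"
    using \<sigma> unfolding contracting_section_def by metis
  let ?g = "\<lambda>t. x + t *\<^sub>R (y - x)"
  have g: "?g t \<in> V" if "0 \<le> t" "t \<le> 1" for t
  proof -
    have "?g t = (1 - t) *\<^sub>R x + t *\<^sub>R y"
      by (simp add: algebra_simps)
    then show ?thesis
      using V xy that by (simp add: convex_alt)
  qed
  have der: "((\<lambda>t. \<sigma> (?g t)) has_derivative (\<lambda>h. D (?g t) (h *\<^sub>R (y - x)))) (at t)"
    if "0 \<le> t" "t \<le> 1" for t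
  proof -
    have "(?g has_derivative (\<lambda>h. h *\<^sub>R (y - x))) (at t)"
      by (auto intro!: derivative_eq_intros)
    from diff_chain_at[OF this] D[OF g[OF that]] show ?thesis
      by (auto simp: o_def)
  qed
  have "continuous_on {0..1} (\<lambda>t. \<sigma> (?g t))"
    by (intro continuous_at_imp_continuous_on ballI has_derivative_continuous[OF der]) auto
  with mvt_general[of 0 1 "\<lambda>t. \<sigma> (?g t)" "\<lambda>t h. D (?g t) (h *\<^sub>R (y - x))"] der
  obtain t where t: "t \<in> {0<..<1}"
    "norm (\<sigma> (?g 1) - \<sigma> (?g 0)) \<le> norm (D (?g t) ((1 - 0) *\<^sub>R (y - x)))"
    by auto
  then have "norm (\<sigma> y - \<sigma> x) \<le> norm (D (?g t) (y - x))"
    by simp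
  also have "\<dots> < norm (y - x)"
    using D[OF g[of t]] t(1) xy by auto
  finally show ?thesis .
qed

text \<open>As for lifts to a covering space: the set of agreement is closed by continuity, and open
  because near a common point of \<open>M\<close> both sections must follow the one local
  sheet.\<close>

lemma contracting_section_unique:
  assumes M: "locally_contracting_graph M" and V: "connected V"
    and \<sigma>: "contracting_section M V \<sigma>" and \<tau>: "contracting_section M V \<tau>"
    and a: "a \<in> V" "\<sigma> a = \<tau> a" and x: "x \<in> V"
  shows "\<sigma> x = \<tau> x"
proof -
  let ?E = "{x \<in> V. \<sigma> x = \<tau> x}"
  note cont = \<sigma>[THEN contracting_section_continuous_on] \<tau>[THEN contracting_section_continuous_on]
  have "?E = {x \<in> V. \<sigma> x - \<tau> x = 0}"
    by auto
  then have "closedin (top_of_set V) ?E"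
    using continuous_closedin_preimage_constant[of V "\<lambda>x. \<sigma> x - \<tau> x" 0] cont
    by (simp add: continuous_on_diff)
  moreover have "openin (top_of_set V) ?E"
    unfolding openin_subopen[of _ ?E]
  proof
    fix y assume y: "y \<in> ?E"
    then have "(y, \<sigma> y) \<in> M"
      using \<sigma> by (auto simp: contracting_section_def)
    then obtain W \<rho> where W: "open W" "(y, \<sigma> y) \<in> W" "\<And>q. q \<in> M \<inter> W \<Longrightarrow> snd q = \<rho> (fst q)"
      using locally_contracting_graphE[OF M] by metis
    let ?T = "(V \<inter> (\<lambda>x. (x, \<sigma> x)) -` W) \<inter> (V \<inter> (\<lambda>x. (x, \<tau> x)) -` W)"
    have "openin (top_of_set V) ?T"
      by (intro openin_Int continuous_openin_preimage_gen continuous_on_Pair continuous_on_id cont W(1))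
    moreover have "y \<in> ?T"
      using y W(2) by auto
    moreover have "?T \<subseteq> ?E"
    proof
      fix z assume z: "z \<in> ?T"
      then have "(z, \<sigma> z) \<in> M \<inter> W" "(z, \<tau> z) \<in> M \<inter> W"
        using \<sigma> \<tau> by (auto simp: contracting_section_def)
      then have "\<sigma> z = \<rho> z" "\<tau> z = \<rho> z"
        using W(3)[of "(z, \<sigma> z)"] W(3)[of "(z, \<tau> z)"] by simp_all
      then show "z \<in> ?E"
        using z by auto
    qed
    ultimately show "\<exists>T. openin (top_of_set V) T \<and> y \<in> T \<and> T \<subseteq> ?E"
      by blast
  qed
  ultimately have "?E = {} \<or> ?E = V"
    using V unfolding connected_clopen by blast
  then show ?thesis
    using a x by auto
qed

section \<open>Lifting segments from the origin into \<open>M\<close>\<close>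

definition liftable :: "('a::euclidean_space \<times> 'b::euclidean_space) set \<Rightarrow> 'a \<Rightarrow> bool"
  where "liftable M x \<longleftrightarrow>
    (\<exists>V \<sigma>. open V \<and> convex V \<and> 0 \<in> V \<and> x \<in> V \<and> \<sigma> 0 = 0 \<and> contracting_section M V \<sigma>)"

lemma liftableE:
  assumes "liftable M x"
  obtains V \<sigma> where "open V" "convex V" "0 \<in> V" "x \<in> V" "\<sigma> 0 = 0" "contracting_section M V \<sigma>"
  using assms unfolding liftable_def by metis

lemma liftableI:
  "open V \<Longrightarrow> convex V \<Longrightarrow> 0 \<in> V \<Longrightarrow> x \<in> V \<Longrightarrow> \<sigma> 0 = 0 \<Longrightarrow> contracting_section M V \<sigma> \<Longrightarrow> liftable M x"
  unfolding liftable_def by metis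

lemma liftable_0:
  fixes M :: "('a::euclidean_space \<times> 'b::euclidean_space) set"
  assumes M: "locally_contracting_graph M" "0 \<in> M"
  shows "liftable M 0"
proof -
  obtain V W \<tau> where V: "open V" "fst (0 :: 'a \<times> 'b) \<in> V" "open W" "0 \<in> W" "contracting_section M V \<tau>"
      "\<And>q. q \<in> M \<inter> W \<Longrightarrow> fst q \<in> V \<and> snd q = \<tau> (fst q)"
    using locally_contracting_graphE[OF M] by blast
  then obtain e where e: "e > 0" "ball 0 e \<subseteq> V"
    by (auto simp: open_contains_ball)
  have "\<tau> 0 = 0"
    using V(6)[of 0] V(4) M(2) by simp
  then show ?thesis
    unfolding liftable_def using e contracting_section_subset[OF V(5) e(2)]
    by (intro exI[of _ "ball 0 e"] exI[of _ \<tau>]) auto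
qed

text \<open>The union is the Minkowski sum of \<open>A\<close> and a ball around 0.\<close>

lemma convex_Union_ball:
  fixes A :: "'a::real_normed_vector set"
  assumes "convex A"
  shows "convex (\<Union>a\<in>A. ball a e)"
proof -
  have "(\<Union>a\<in>A. ball a e) = (\<Union>a\<in>A. \<Union>b\<in>ball 0 e. {a + b})"
    by (auto simp: dist_norm) (metis add_diff_cancel_left' diff_add_cancel dist_norm norm_minus_commute mem_ball_0 add.commute)
  then show ?thesis
    using convex_sums[OF assms convex_ball, of 0 e] by simp
qed

text \<open>The lifts over the shorter segments form one Lipschitz curve in \<open>M\<close>, which
  has a limit over \<open>x\<close>; closedness puts the limit in \<open>M\<close>. The local sheet
  there is then glued to a lift that comes close enough to it.\<close>

lemma liftable_limit:
  assumes M: "locally_contracting_graph M" "closed M"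
    and lift: "\<And>t. 0 \<le> t \<Longrightarrow> t < 1 \<Longrightarrow> liftable M (t *\<^sub>R x)"
  shows "liftable M x"
proof -
  have "\<exists>V \<sigma>. 0 \<le> t \<and> t < 1 \<longrightarrow> open V \<and> convex V \<and> 0 \<in> V \<and> t *\<^sub>R x \<in> V \<and> \<sigma> 0 = 0 \<and> contracting_section M V \<sigma>" for t
    using lift unfolding liftable_def by blast
  then obtain V \<sigma> where V: "\<And>t. 0 \<le> t \<Longrightarrow> t < 1 \<Longrightarrow> open (V t) \<and> convex (V t) \<and> 0 \<in> V t \<and> t *\<^sub>R x \<in> V t"
      and \<sigma>: "\<And>t. 0 \<le> t \<Longrightarrow> t < 1 \<Longrightarrow> \<sigma> t 0 = 0 \<and> contracting_section M (V t) (\<sigma> t)"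
    by metis
  define y where "y t = \<sigma> t (t *\<^sub>R x)" for t
  have in_V: "s *\<^sub>R x \<in> V t" if "0 \<le> s" "s \<le> t" "t < 1" for s t
  proof (cases "t = 0")
    case False
    then have "(1 - s / t) *\<^sub>R 0 + (s / t) *\<^sub>R (t *\<^sub>R x) \<in> V t"
      using V[of t] that by (intro convexD) auto
    then show ?thesis
      using False by simp
  qed (use V[of t] that in auto)
  have y_eq: "y s = \<sigma> t (s *\<^sub>R x)" if st: "0 \<le> s" "s \<le> t" "t < 1" for s t
  proof -
    \<comment> \<open>This is why \<open>liftable\<close> asks for convex domains containing 0:
      their intersections are connected and share a point where the lifts agree.\<close>
    have conn: "connected (V s \<inter> V t)"
      using V st by (intro convex_connected convex_Int) auto
    have sec: "contracting_section M (V s \<inter> V t) (\<sigma> s)" "contracting_section M (V s \<inter> V t) (\<sigma> t)"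
      using \<sigma>[of s] \<sigma>[of t] st by (auto intro: contracting_section_subset)
    have 0: "0 \<in> V s \<inter> V t" "\<sigma> s 0 = \<sigma> t 0"
      using V[of s] V[of t] \<sigma>[of s] \<sigma>[of t] st by auto
    have "s *\<^sub>R x \<in> V s \<inter> V t"
      using in_V[of s s] in_V[of s t] st by simp
    from contracting_section_unique[OF M(1) conn sec 0 this]
    have "\<sigma> s (s *\<^sub>R x) = \<sigma> t (s *\<^sub>R x)" .
    then show ?thesis
      by (simp add: y_def)
  qed
  \<comment> \<open>Both values come from the one section \<open>\<sigma> t\<close> on a convex
    domain, where increments are controlled.\<close>
  have y_dist: "dist (y s) (y t) \<le> \<bar>s - t\<bar> * norm x" if "0 \<le> s" "s \<le> t" "t < 1" for s t
  proof (cases "s *\<^sub>R x = t *\<^sub>R x")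
    case same: True
    have "y s = y t"
      using y_eq[OF that] unfolding same by (simp add: y_def)
    then show ?thesis
      by simp
  next
    case False
    then have "norm (\<sigma> t (t *\<^sub>R x) - \<sigma> t (s *\<^sub>R x)) < norm (t *\<^sub>R x - s *\<^sub>R x)"
      using V[of t] \<sigma>[of t] that in_V by (intro contracting_section_norm_less[of M "V t"]) auto
    then show ?thesis
      using y_eq[OF that] y_eq[of t t] that
      by (simp add: dist_norm norm_minus_commute flip: scaleR_diff_left)
  qed
  define t where "t k = 1 - 1 / (real k + 1)" for k
  have t: "0 \<le> t k" "t k < 1" for k
    by (auto simp: t_def)
  have t_lim: "t \<longlonglongrightarrow> 1"
    unfolding t_def using tendsto_diff[OF tendsto_const[of 1] LIMSEQ_inverse_real_of_nat]
    by (simp add: inverse_eq_divide add.commute)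
  have "Cauchy (\<lambda>k. y (t k))"
  proof (rule metric_CauchyI)
    fix e :: real assume "0 < e"
    \<comment> \<open>The summand 1 keeps the denominator positive when
      \<open>x = 0\<close>.\<close>
    then have pos: "0 < e / (norm x + 1)"
      by (simp add: add_nonneg_pos)
    have "Cauchy t"
      using t_lim by (simp add: LIMSEQ_imp_Cauchy)
    then obtain N where N: "\<And>m n. m \<ge> N \<Longrightarrow> n \<ge> N \<Longrightarrow> dist (t m) (t n) < e / (norm x + 1)"
      using pos metric_CauchyD by metis
    have "dist (y (t m)) (y (t n)) < e" if mn: "m \<ge> N" "n \<ge> N" for m n
    proof -
      have "dist (y (t m)) (y (t n)) \<le> \<bar>t m - t n\<bar> * norm x"
        using y_dist[of "t m" "t n"] y_dist[of "t n" "t m"] t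
        by (cases "t m \<le> t n") (auto simp: dist_commute abs_minus_commute)
      also have "\<dots> \<le> \<bar>t m - t n\<bar> * (norm x + 1)"
        by (intro mult_left_mono) auto
      also have "\<dots> < e"
        using N[OF mn] by (simp add: dist_real_def pos_less_divide_eq add_nonneg_pos)
      finally show ?thesis .
    qed
    then show "\<exists>N. \<forall>m\<ge>N. \<forall>n\<ge>N. dist (y (t m)) (y (t n)) < e"
      by blast
  qed
  then obtain z where z: "(\<lambda>k. y (t k)) \<longlonglongrightarrow> z"
    using Cauchy_convergent convergent_def by blast
  have x_lim: "(\<lambda>k. t k *\<^sub>R x) \<longlonglongrightarrow> x"
    using tendsto_scaleR[OF t_lim tendsto_const[of x]] by simp
  have lim: "(\<lambda>k. (t k *\<^sub>R x, y (t k))) \<longlonglongrightarrow> (x, z)"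
    by (intro tendsto_Pair x_lim z)
  have in_M: "(t k *\<^sub>R x, y (t k)) \<in> M" for k
    using \<sigma>[OF t, of k] V[OF t, of k] by (auto simp: y_def contracting_section_def)
  have "(x, z) \<in> M"
    using closed_sequentially[OF M(2) in_M lim] .
  then obtain U W \<tau> where U: "open U" "x \<in> U" "open W" "(x, z) \<in> W" "contracting_section M U \<tau>"
      and W: "\<And>q. q \<in> M \<inter> W \<Longrightarrow> fst q \<in> U \<and> snd q = \<tau> (fst q)"
    using locally_contracting_graphE[OF M(1) \<open>(x, z) \<in> M\<close>] by (metis fst_conv)
  obtain e where e: "e > 0" "ball x e \<subseteq> U"
    using U(1,2) by (auto simp: open_contains_ball)
  have "\<forall>\<^sub>F k in sequentially. (t k *\<^sub>R x, y (t k)) \<in> W \<and> t k *\<^sub>R x \<in> ball x e"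
    using topological_tendstoD[OF lim U(3,4)] topological_tendstoD[OF x_lim, of "ball x e"] e(1)
    by (simp add: eventually_conj)
  then obtain k where k: "(t k *\<^sub>R x, y (t k)) \<in> W" "t k *\<^sub>R x \<in> ball x e"
    using eventually_happens by (metis (no_types, lifting) sequentially_bot)
  \<comment> \<open>At this parameter the curve already lies on the sheet through the limit point,
    so \<open>\<sigma> s\<close> and \<open>\<tau>\<close> agree at
    \<open>s *\<^sub>R x\<close>.\<close>
  define s where "s = t k"
  have s: "0 \<le> s" "s < 1"
    using t by (auto simp: s_def)
  note Vs = V[OF s] and \<sigma>s = \<sigma>[OF s]
  have \<tau>: "contracting_section M (ball x e) \<tau>"
    using U(5) e(2) by (rule contracting_section_subset)
  have agree: "\<sigma> s w = \<tau> w" if w: "w \<in> V s \<inter> ball x e" for w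
  proof -
    have conn: "connected (V s \<inter> ball x e)"
      using Vs by (intro convex_connected convex_Int) auto
    have sec: "contracting_section M (V s \<inter> ball x e) (\<sigma> s)" "contracting_section M (V s \<inter> ball x e) \<tau>"
      using \<sigma>s \<tau> by (auto intro: contracting_section_subset)
    have mem: "s *\<^sub>R x \<in> V s \<inter> ball x e"
      using Vs k(2) by (simp add: s_def)
    have eq: "\<sigma> s (s *\<^sub>R x) = \<tau> (s *\<^sub>R x)"
      using W[OF IntI[OF in_M k(1)]] by (simp add: y_def s_def)
    show ?thesis
      by (rule contracting_section_unique[OF M(1) conn sec mem eq w])
  qed
  define \<rho> where "\<rho> w = (if w \<in> V s then \<sigma> s w else \<tau> w)" for w
  have "contracting_section M (V s) \<rho>" 
    by (rule contracting_section_cong[of _ _ "\<sigma> s"]) (use Vs \<sigma>s in \<open>auto simp: \<rho>_def\<close>)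
  moreover have "contracting_section M (ball x e) \<rho>"
    by (rule contracting_section_cong[OF \<tau>]) (use agree in \<open>auto simp: \<rho>_def\<close>)
  ultimately have \<rho>: "contracting_section M (V s \<union> ball x e) \<rho>"
    by (auto simp: contracting_section_def)
  have seg: "closed_segment 0 x \<subseteq> V s \<union> ball x e"
  proof
    fix w assume "w \<in> closed_segment 0 x"
    then obtain r where r: "0 \<le> r" "r \<le> 1" "w = r *\<^sub>R x"
      by (auto simp: closed_segment_def)
    show "w \<in> V s \<union> ball x e"
    proof (cases "r \<le> s")
      case True
      then show ?thesis
        using in_V[of r s] s r by auto
    next
      case False
      have "dist x w = (1 - r) * norm x"
        using r by (simp add: dist_norm flip: scaleR_left_diff_distrib[of 1 r x, simplified])
      also have "\<dots> \<le> (1 - s) * norm x"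
        using False by (intro mult_right_mono) auto
      also have "\<dots> = dist x (s *\<^sub>R x)"
        using s by (simp add: dist_norm flip: scaleR_left_diff_distrib[of 1 s x, simplified])
      also have "\<dots> < e"
        using k(2) by (simp add: s_def)
      finally show ?thesis
        by simp
    qed
  qed
  \<comment> \<open>The union of the two domains may fail to be convex. By compactness a thin tube
    around the segment fits inside it, and the tube is convex.\<close>
  obtain d where d: "d > 0" "(\<Union>w\<in>closed_segment 0 x. ball w d) \<subseteq> V s \<union> ball x e"
    using compact_subset_open_imp_ball_epsilon_subset[OF compact_segment _ seg] Vs by auto
  show ?thesis
    unfolding liftable_def
  proof (intro exI conjI)
    show "contracting_section M (\<Union>w\<in>closed_segment 0 x. ball w d) \<rho>"
      using \<rho> d(2) by (rule contracting_section_subset)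
    show "convex (\<Union>w\<in>closed_segment 0 x. ball w d)"
      by (intro convex_Union_ball convex_closed_segment)
    show "\<rho> 0 = 0"
      using Vs \<sigma>s by (simp add: \<rho>_def)
    show "open (\<Union>w\<in>closed_segment 0 x. ball w d)"
      by blast
    show "0 \<in> (\<Union>w\<in>closed_segment 0 x. ball w d)" "x \<in> (\<Union>w\<in>closed_segment 0 x. ball w d)"
      using d(1) by (meson UN_I centre_in_ball ends_in_segment)+
  qed
qed

text \<open>Continuity method along the ray through \<open>x\<close>: liftable parameters include 0,
  their supremum is liftable by \<open>liftable_limit\<close>, and a supremum below 1 could be
  exceeded because the domain of a lift is open.\<close>

lemma liftable_all:
  assumes M: "locally_contracting_graph M" "closed M" "0 \<in> M"
  shows "liftable M x"
proof -
  have down: "liftable M (s *\<^sub>R y)" if y: "liftable M y" and s: "0 \<le> s" "s \<le> 1" for s y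
  proof -
    obtain V \<sigma> where V: "open V" "convex V" "0 \<in> V" "y \<in> V" "\<sigma> 0 = 0" "contracting_section M V \<sigma>"
      using y by (rule liftableE)
    then have "(1 - s) *\<^sub>R 0 + s *\<^sub>R y \<in> V"
      using s by (intro convexD) auto
    then have "s *\<^sub>R y \<in> V"
      by simp
    then show ?thesis
      by (rule liftableI[OF V(1-3) _ V(5,6)])
  qed
  define S where "S = {t \<in> {0..1}. liftable M (t *\<^sub>R x)}"
  have S01: "S \<subseteq> {0..1}"
    by (auto simp: S_def)
  then have S: "0 \<in> S" "bdd_above S"
    using liftable_0[OF M(1,3)] bdd_above_mono[OF bdd_above_Icc] by (simp_all add: S_def)
  define m where "m = Sup S"
  have m: "0 \<le> m" "m \<le> 1"
    unfolding m_def using S S01 by (auto intro!: cSup_upper cSup_least)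
  have "liftable M (t *\<^sub>R (m *\<^sub>R x))" if "0 \<le> t" "t < 1" for t
  proof (cases "m = 0")
    case True
    then show ?thesis
      using liftable_0[OF M(1,3)] by simp
  next
    case False
    then have "t * m < m"
      using m that by simp
    \<comment> \<open>Since \<open>t * m\<close> is below the supremum, some liftable parameter
      \<open>r\<close> exceeds it, and the lift up to \<open>r\<close> restricts to
      \<open>t * m\<close>.\<close>
    then obtain r where r: "r \<in> S" "t * m < r"
      using less_cSup_iff[of S "t * m"] S by (auto simp: m_def)
    have "0 \<le> t * m"
      using that m by simp
    then have "r > 0"
      using r(2) by simp
    have "liftable M ((t * m / r) *\<^sub>R (r *\<^sub>R x))"
      by (rule down) (use r \<open>0 \<le> t * m\<close> \<open>r > 0\<close> in \<open>simp_all add: S_def\<close>)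
    then show ?thesis
      using \<open>r > 0\<close> by simp
  qed
  then have lift_m: "liftable M (m *\<^sub>R x)"
    by (rule liftable_limit[OF M(1,2)])
  have "m = 1"
  proof (rule ccontr)
    assume "m \<noteq> 1"
    then have m1: "m < 1"
      using m by simp
    obtain V \<sigma> where V: "open V" "convex V" "0 \<in> V" "m *\<^sub>R x \<in> V" "\<sigma> 0 = 0" "contracting_section M V \<sigma>"
      using lift_m by (rule liftableE)
    have "((\<lambda>t. t *\<^sub>R x) \<longlongrightarrow> m *\<^sub>R x) (at_right m)"
      by (intro tendsto_intros)
    then have "\<forall>\<^sub>F t in at_right m. t *\<^sub>R x \<in> V"
      using V by (auto dest: topological_tendstoD)
    moreover have "\<forall>\<^sub>F t in at_right m. t \<in> {m<..<1}"
      using m1 by (rule eventually_at_right_real)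
    ultimately have "\<forall>\<^sub>F t in at_right m. t *\<^sub>R x \<in> V \<and> t \<in> {m<..<1}"
      by (rule eventually_conj)
    then have "\<exists>t. t *\<^sub>R x \<in> V \<and> t \<in> {m<..<1}"
      by (rule eventually_happens'[rotated]) simp
    then obtain t where t: "t *\<^sub>R x \<in> V" "t \<in> {m<..<1}"
      by blast
    have "liftable M (t *\<^sub>R x)"
      by (rule liftableI[OF V(1-3) t(1) V(5,6)])
    then have "t \<in> S"
      using t(2) m by (simp add: S_def)
    then show False
      using cSup_upper[of t S] S(2) t(2) by (simp add: m_def)
  qed
  with lift_m show ?thesis
    by simp
qed

text \<open>By uniqueness the lifts to all points are restrictions of one map \<open>u\<close>. Its
  graph is open and closed in \<open>M\<close>, hence all of the connected \<open>M\<close>.\<close>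

theorem closed_connected_graph:
  assumes M: "locally_contracting_graph M" "closed M" "connected M" "0 \<in> M"
  obtains u where "contracting_section M UNIV u" "u 0 = 0" "M = range (\<lambda>x. (x, u x))"
proof -
  have "\<exists>V \<sigma>. open V \<and> convex V \<and> 0 \<in> V \<and> x \<in> V \<and> \<sigma> 0 = 0 \<and> contracting_section M V \<sigma>" for x
    using liftable_all[OF M(1,2,4)] unfolding liftable_def .
  then obtain V \<sigma> where V: "\<And>x. open (V x)" "\<And>x. convex (V x)" "\<And>x. 0 \<in> V x" "\<And>x. x \<in> V x"
      and \<sigma>: "\<And>x. \<sigma> x 0 = 0" "\<And>x. contracting_section M (V x) (\<sigma> x)"
    by metis
  define u where "u x = \<sigma> x x" for x
  have u_eq: "u z = \<sigma> x z" if "z \<in> V x" for x z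
  proof -
    have conn: "connected (V z \<inter> V x)"
      by (intro convex_connected convex_Int V)
    have sec: "contracting_section M (V z \<inter> V x) (\<sigma> z)" "contracting_section M (V z \<inter> V x) (\<sigma> x)"
      using \<sigma>(2) by (auto intro: contracting_section_subset)
    have 0: "0 \<in> V z \<inter> V x" "\<sigma> z 0 = \<sigma> x 0" and z: "z \<in> V z \<inter> V x"
      using V \<sigma> that by auto
    show ?thesis
      unfolding u_def by (rule contracting_section_unique[OF M(1) conn sec 0 z])
  qed
  have u: "contracting_section M UNIV u"
  proof -
    have "contracting_section M (V x) u" for x
      by (rule contracting_section_cong[OF \<sigma>(2)]) (use V u_eq in auto)
    then show ?thesis
      using V(4) unfolding contracting_section_def by blast
  qed
  have cont: "continuous_on UNIV u"
    using u by (rule contracting_section_continuous_on)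
  let ?G = "range (\<lambda>x. (x, u x))"
  have G: "?G \<subseteq> M"
    using u by (auto simp: contracting_section_def)
  have "?G = {p. snd p - u (fst p) = 0}"
    by (auto simp: image_iff)
  moreover have "closed {p. snd p - u (fst p) = 0}"
    by (intro closed_Collect_eq continuous_intros continuous_on_compose2[OF cont]) auto
  ultimately have "closedin (top_of_set M) ?G"
    using G by (simp add: closed_subset)
  \<comment> \<open>Near a point of the graph, \<open>M\<close> is a single sheet, and uniqueness
    identifies this sheet with the graph of \<open>u\<close>.\<close>
  moreover have "openin (top_of_set M) ?G"
    unfolding openin_subopen[of _ ?G]
  proof
    fix p assume p: "p \<in> ?G"
    then have "p \<in> M"
      using G by auto
    then obtain U W \<tau> where U: "open U" "fst p \<in> U" "open W" "p \<in> W" "contracting_section M U \<tau>"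
        and W: "\<And>q. q \<in> M \<inter> W \<Longrightarrow> fst q \<in> U \<and> snd q = \<tau> (fst q)"
      using locally_contracting_graphE[OF M(1) \<open>p \<in> M\<close>] by metis
    obtain e where e: "e > 0" "ball (fst p) e \<subseteq> U"
      using U(1,2) by (auto simp: open_contains_ball)
    have eq: "u x = \<tau> x" if x: "x \<in> ball (fst p) e" for x
    proof -
      have sec: "contracting_section M (ball (fst p) e) u" "contracting_section M (ball (fst p) e) \<tau>"
        using u U(5) e(2) by (auto intro: contracting_section_subset)
      have mem: "fst p \<in> ball (fst p) e" and val: "u (fst p) = \<tau> (fst p)"
        using W[of p] \<open>p \<in> M\<close> U(4) p e(1) by auto
      show ?thesis
        by (rule contracting_section_unique[OF M(1) connected_ball sec mem val x])
    qed
    let ?T = "M \<inter> (W \<inter> ball (fst p) e \<times> UNIV)"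
    have "openin (top_of_set M) ?T"
      using U(3) by (intro openin_open_Int open_Int open_Times) auto
    moreover have "p \<in> ?T"
      using \<open>p \<in> M\<close> U(4) e(1) by (simp add: mem_Times_iff)
    moreover have "?T \<subseteq> ?G"
    proof
      fix q assume q: "q \<in> ?T"
      then have "snd q = u (fst q)"
        using W[of q] eq by (auto simp: mem_Times_iff)
      then show "q \<in> ?G"
        by (intro image_eqI[of _ _ "fst q"]) (auto simp: prod_eq_iff)
    qed
    ultimately show "\<exists>T. openin (top_of_set M) T \<and> p \<in> T \<and> T \<subseteq> ?G"
      by blast
  qed
  ultimately have "?G = M"
    using M(3) unfolding connected_clopen by blast
  moreover have "u 0 = 0"
    using \<sigma>(1) by (simp add: u_def)
  ultimately show ?thesis
    using u that by blast
qed


subsection \<open>Local parametrizations of space-like submanifolds\<close>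

lemma local_param_has_derivative:
  assumes "local_param M U \<phi>" "w \<in> U"
  shows "(\<phi> has_derivative frechet_derivative \<phi> (at w)) (at w)"
proof -
  have "Ck_on (Suc 0) U \<phi>"
    using assms(1) unfolding local_param_def smooth_on_def by blast
  then show ?thesis
    using assms(2) by (simp add: frechet_derivative_works)
qed

lemma local_param_linear:
  assumes "local_param M U \<phi>" "w \<in> U"
  shows "linear (frechet_derivative \<phi> (at w))"
  using local_param_has_derivative[OF assms] by (rule has_derivative_linear)

lemma local_param_continuous_derivative:
  assumes "local_param M U \<phi>"
  shows "continuous_on U (\<lambda>w. frechet_derivative \<phi> (at w) v)"
proof -
  have "Ck_on (Suc 0) U \<phi>"
    using assms unfolding local_param_def smooth_on_def by blast
  then show ?thesis
    by simp
qed

lemma local_param_continuous: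
  assumes "local_param M U \<phi>"
  shows "continuous_on U \<phi>"
  by (intro continuous_at_imp_continuous_on ballI has_derivative_continuous[OF local_param_has_derivative[OF assms]])

lemma local_param_image_subset:
  assumes "local_param M U \<phi>"
  shows "\<phi> ` U \<subseteq> M"
  using assms openin_imp_subset unfolding local_param_def by blast

lemma local_param_inj_on:
  assumes "local_param M U \<phi>"
  shows "inj_on \<phi> U"
  using assms unfolding local_param_def homeomorphism_def by (metis inj_on_inverseI)

section \<open>Space-like tangent vectors and local graphs\<close>

lemma spacelike_pinner_pos:
  assumes M: "spacelike M" and \<phi>: "local_param M U \<phi>" and w: "w \<in> U" and v: "v \<noteq> 0"
  shows "pinner (frechet_derivative \<phi> (at w) v) (frechet_derivative \<phi> (at w) v) > 0"
proof -
  let ?L = "frechet_derivative \<phi> (at w)"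
  have "\<phi> w \<in> M"
    using local_param_image_subset[OF \<phi>] w by blast
  moreover have "?L v \<in> tangent_space M (\<phi> w)"
    unfolding tangent_space_def using \<phi> w by blast
  moreover have "?L v \<noteq> 0"
  proof -
    have "inj ?L"
      using \<phi> w unfolding local_param_def by blast
    then show ?thesis
      using v linear_injective_0[OF local_param_linear[OF \<phi> w]] by blast
  qed
  ultimately show ?thesis
    using M unfolding spacelike_def by blast
qed

lemma spacelike_norm_less:
  assumes "spacelike M" "local_param M U \<phi>" "w \<in> U" "v \<noteq> 0"
  shows "norm (snd (frechet_derivative \<phi> (at w) v)) < norm (fst (frechet_derivative \<phi> (at w) v))"
  using spacelike_pinner_pos[OF assms] by (simp add: pinner_def norm_lt)

text \<open>The inverse function theorem inverts the projected parametrization \<open>f\<close> by a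
  map \<open>g\<close>, and \<open>snd (\<phi> (g y))\<close> is the graph map. Its derivative sends
  the space-like part of a tangent vector to its time-like part, which is shorter.\<close>

lemma spacelike_locally_contracting_graph:
  fixes M :: "('n::finite, 'm::finite) pseudo_euclidean set"
  assumes sub: "submanifold M" and M: "spacelike M"
  shows "locally_contracting_graph M"
  unfolding locally_contracting_graph_def
proof
  fix p assume "p \<in> M"
  then obtain U \<phi> w0 where \<phi>: "local_param M U \<phi>" and w0: "w0 \<in> U" "p = \<phi> w0"
    using sub unfolding submanifold_def by blast
  have U: "open U"
    using \<phi> unfolding local_param_def by blast
  define L where "L w = frechet_derivative \<phi> (at w)" for w
  define f where "f w = fst (\<phi> w)" for w
  \<comment> \<open>The inverse function theorem asks for a derivative continuous as a map into
    bounded linear functions; in finite dimension this is checked vector by vector.\<close>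
  define f' where "f' w = Blinfun (\<lambda>v. fst (L w v))" for w
  have L: "(\<phi> has_derivative L w) (at w)" if "w \<in> U" for w
    unfolding L_def by (rule local_param_has_derivative[OF \<phi> that])
  have f'_apply: "blinfun_apply (f' w) = (\<lambda>v. fst (L w v))" if "w \<in> U" for w
    unfolding f'_def
    by (intro bounded_linear_Blinfun_apply bounded_linear_fst_comp has_derivative_bounded_linear[OF L[OF that]])
  have less: "norm (snd (L w v)) < norm (fst (L w v))" if "w \<in> U" "v \<noteq> 0" for w v
    unfolding L_def by (rule spacelike_norm_less[OF M \<phi> that])
  have derf: "(f has_derivative blinfun_apply (f' w)) (at w)" if "w \<in> U" for w
    unfolding f'_apply[OF that] f_def using L[OF that] by (rule has_derivative_fst)
  have contf: "continuous_on U f'"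
  proof (rule continuous_on_blinfun_componentwise)
    fix i :: "real^'n"
    have "continuous_on U (\<lambda>w. fst (L w i))"
      unfolding L_def by (intro continuous_on_fst local_param_continuous_derivative[OF \<phi>])
    then show "continuous_on U (\<lambda>w. blinfun_apply (f' w) i)"
      by (rule continuous_on_eq) (simp add: f'_apply)
  qed
  have lin: "linear (\<lambda>v. fst (L w0 v))"
    using has_derivative_linear[OF derf[OF w0(1)]] f'_apply[OF w0(1)] by simp
  \<comment> \<open>For \<open>v \<noteq> 0\<close> the norm of the first component strictly exceeds
    another norm, so it cannot vanish.\<close>
  have "inj (\<lambda>v. fst (L w0 v))"
    unfolding linear_injective_0[OF lin]
    using less[OF w0(1)] by (metis norm_ge_zero norm_zero not_less)
  then obtain h where h: "linear h" "\<And>x. h (fst (L w0 x)) = x"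
    using linear_injective_isomorphism[OF lin] by blast
  have "Blinfun h o\<^sub>L f' w0 = id_blinfun"
    using h by (intro blinfun_eqI)
      (simp add: f'_apply[OF w0(1)] bounded_linear_Blinfun_apply linear_conv_bounded_linear)
  then obtain U' V g g' where U': "open U'" "U' \<subseteq> U" "w0 \<in> U'" and V: "open V" "f w0 \<in> V"
      and hom: "homeomorphism U' V f g"
      and derg: "\<And>y. y \<in> V \<Longrightarrow> (g has_derivative g' y) (at y)"
      and g': "\<And>y. y \<in> V \<Longrightarrow> g' y = inv (blinfun_apply (f' (g y)))"
      and bij: "\<And>y. y \<in> V \<Longrightarrow> bij (blinfun_apply (f' (g y)))"
    using inverse_function_theorem[OF U derf contf w0(1), of "Blinfun h"] by metis
  define \<tau> where "\<tau> y = snd (\<phi> (g y))" for y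
  have gV: "g y \<in> U'" "f (g y) = y" if "y \<in> V" for y
    using hom that by (auto simp: homeomorphism_def)
  have \<tau>: "contracting_section M V \<tau>"
    unfolding contracting_section_def
  proof (intro ballI conjI)
    fix y assume y: "y \<in> V"
    then have gy: "g y \<in> U"
      using gV U'(2) by blast
    have "(y, \<tau> y) = \<phi> (g y)"
      using gV(2)[OF y] by (simp add: f_def \<tau>_def prod_eq_iff)
    then show "(y, \<tau> y) \<in> M"
      using local_param_image_subset[OF \<phi>] gy by auto
    have "(\<tau> has_derivative (\<lambda>v. snd (L (g y) (g' y v)))) (at y)"
      unfolding \<tau>_def using diff_chain_at[OF derg[OF y] L[OF gy]]
      by (intro has_derivative_snd) (simp add: o_def)
    moreover have "norm (snd (L (g y) (g' y v))) < norm v" if "v \<noteq> 0" for v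
    proof -
      have fst: "fst (L (g y) (g' y v)) = v"
        using bij_is_surj[OF bij[OF y]] g'[OF y] f'_apply[OF gy] by (metis surj_f_inv_f)
      then have "g' y v \<noteq> 0"
        using that linear_0[OF has_derivative_linear[OF L[OF gy]]] by auto
      from less[OF gy this] show ?thesis
        by (simp add: fst)
    qed
    ultimately show "\<exists>D. (\<tau> has_derivative D) (at y) \<and> (\<forall>v. v \<noteq> 0 \<longrightarrow> norm (D v) < norm v)"
      by blast
  qed
  obtain \<psi> where \<psi>: "homeomorphism U (\<phi> ` U) \<phi> \<psi>" and op: "openin (top_of_set M) (\<phi> ` U)"
    using \<phi> unfolding local_param_def by blast
  \<comment> \<open>As \<open>\<phi>\<close> is a homeomorphism onto a relatively open set, no other
    part of \<open>M\<close> accumulates on this sheet: some ambient open \<open>W\<close> meets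
    \<open>M\<close> in exactly the sheet.\<close>
  have "openin (top_of_set U) U'"
    using U' U by (simp add: openin_open_eq)
  then have "openin (top_of_set (\<phi> ` U)) (\<phi> ` U')"
    by (rule homeomorphism_imp_open_map[OF \<psi>])
  then have "openin (top_of_set M) (\<phi> ` U')"
    using op by (rule openin_trans)
  then obtain W where W: "open W" "\<phi> ` U' = M \<inter> W"
    unfolding openin_open by blast
  have graph: "fst q \<in> V \<and> snd q = \<tau> (fst q)" if q: "q \<in> M \<inter> W" for q
  proof -
    obtain w where w: "w \<in> U'" "q = \<phi> w"
      using q W(2) by blast
    then have "f w \<in> V" "g (f w) = w"
      using hom by (auto simp: homeomorphism_def)
    then show ?thesis
      using w by (simp add: f_def \<tau>_def)
  qed
  have "fst p \<in> V" "p \<in> W"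
    using V(2) U'(3) W(2) w0(2) by (auto simp: f_def)
  with V(1) W(1) \<tau> graph
  show "\<exists>V W \<tau>. open V \<and> fst p \<in> V \<and> open W \<and> p \<in> W \<and> contracting_section M V \<tau> \<and>
      (\<forall>q\<in>M \<inter> W. fst q \<in> V \<and> snd q = \<tau> (fst q))"
    by blast
qed


subsection \<open>The volume of a space-like graph\<close>

lemma pinner_commute: "pinner v w = pinner w v"
  by (simp add: pinner_def inner_commute)

text \<open>Bilinear expansion of \<open>L v\<close> in the standard basis: the Gram matrix
  represents the pulled-back quadratic form.\<close>

lemma inner_pinner_gram:
  fixes L :: "real^'n \<Rightarrow> ('n::finite, 'm::finite) pseudo_euclidean"
  assumes "linear L"
  shows "v \<bullet> ((\<chi> i j. pinner (L (axis i 1)) (L (axis j 1))) *v v) = pinner (L v) (L v)"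
proof -
  have "L v = L (\<Sum>i\<in>UNIV. v $ i *\<^sub>R axis i 1)"
    using basis_expansion[of v] by (simp add: scalar_mult_eq_scaleR)
  also have "\<dots> = (\<Sum>i\<in>UNIV. v $ i *\<^sub>R L (axis i 1))"
    using assms by (simp add: linear_sum linear_scale)
  finally have L: "L v = (\<Sum>i\<in>UNIV. v $ i *\<^sub>R L (axis i 1))" .
  have left: "pinner (\<Sum>i\<in>UNIV. v $ i *\<^sub>R L (axis i 1)) y = (\<Sum>i\<in>UNIV. v $ i * pinner (L (axis i 1)) y)" for y
    by (simp add: pinner_def fst_sum snd_sum inner_sum_left sum_subtractf right_diff_distrib)
  have "pinner (L v) (L v) = (\<Sum>i\<in>UNIV. v $ i * (\<Sum>j\<in>UNIV. v $ j * pinner (L (axis j 1)) (L (axis i 1))))"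
    unfolding L left by (subst pinner_commute) (simp add: left)
  then show ?thesis
    by (simp add: inner_vec_def matrix_vector_mult_def mult.commute pinner_commute)
qed

text \<open>Dropping the negative part of \<open>pinner\<close> bounds the induced quadratic form by
  the squared length of the projected vector, so projecting to the space-like factor does not
  decrease volume.\<close>

lemma sqrt_det_induced_metric_le:
  assumes M: "spacelike M" and \<phi>: "local_param M U \<phi>" and w: "w \<in> U"
  shows "sqrt (det (induced_metric \<phi> w)) \<le> \<bar>det (matrix (\<lambda>v. fst (frechet_derivative \<phi> (at w) v)))\<bar>"
proof (rule sqrt_det_le_abs_det)
  let ?L = "frechet_derivative \<phi> (at w)"
  have L: "linear ?L"
    by (rule local_param_linear[OF \<phi> w])
  have q: "v \<bullet> (induced_metric \<phi> w *v v) = pinner (?L v) (?L v)" for v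
    unfolding induced_metric_def by (rule inner_pinner_gram[OF L])
  show "transpose (induced_metric \<phi> w) = induced_metric \<phi> w"
    by (simp add: transpose_def induced_metric_def vec_eq_iff pinner_commute)
  show "0 < v \<bullet> (induced_metric \<phi> w *v v)" if "v \<noteq> 0" for v
    unfolding q by (rule spacelike_pinner_pos[OF M \<phi> w that])
  show "v \<bullet> (induced_metric \<phi> w *v v) \<le> (norm (matrix (\<lambda>v. fst (?L v)) *v v))\<^sup>2" for v
  proof -
    have "linear (\<lambda>v. fst (?L v))"
      using linear_compose[OF L linear_fst] by (simp add: o_def)
    then show ?thesis
      unfolding q by (simp add: matrix_works pinner_def power2_norm_eq_inner)
  qed
qed

lemma continuous_on_det:
  fixes A :: "'a::topological_space \<Rightarrow> real^'n^'n"
  assumes "\<And>i j. continuous_on S (\<lambda>x. A x $ i $ j)"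
  shows "continuous_on S (\<lambda>x. det (A x))"
  unfolding det_def by (intro continuous_intros assms)

text \<open>The density is at most the Jacobian of the projection \<open>f\<close>, which is
  injective because \<open>M\<close> lies on a graph. Change of variables then bounds the measure of
  \<open>A\<close> by the Lebesgue measure of the projection of its part in the patch.\<close>

lemma patch_measure_le:
  fixes M :: "('n::finite, 'm::finite) pseudo_euclidean set"
  assumes M: "spacelike M" and \<phi>: "local_param M U \<phi>"
    and graph: "\<And>p. p \<in> M \<Longrightarrow> snd p = u (fst p)" and u: "continuous_on UNIV u"
  shows "patch_measure U \<phi> \<le> distr lborel borel (\<lambda>x. (x, u x))"
proof -
  define L where "L w = frechet_derivative \<phi> (at w)" for w
  define f where "f w = fst (\<phi> w)" for w
  have U: "open U"
    using \<phi> unfolding local_param_def by blast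
  have "continuous_on U (\<lambda>w. sqrt (det (induced_metric \<phi> w)))"
    by (intro continuous_intros continuous_on_det)
      (simp add: induced_metric_def pinner_def, intro continuous_intros local_param_continuous_derivative[OF \<phi>])
  then have "(\<lambda>w. sqrt (det (induced_metric \<phi> w))) \<in> borel_measurable (restrict_space borel U)"
    by (rule borel_measurable_continuous_on_restrict)
  then have "(\<lambda>w. ennreal (sqrt (det (induced_metric \<phi> w)))) \<in> borel_measurable (restrict_space borel U)"
    by (rule measurable_compose[OF _ measurable_ennreal])
  moreover have restrict: "sets (restrict_space lborel U) = sets (restrict_space borel U)"
    by (intro sets_restrict_space_cong) simp
  ultimately have g: "(\<lambda>w. ennreal (sqrt (det (induced_metric \<phi> w)))) \<in> borel_measurable (restrict_space lborel U)"
    unfolding measurable_cong_sets[OF restrict refl] by blast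
  have \<phi>_meas: "\<phi> \<in> borel_measurable (restrict_space lborel U)"
    unfolding measurable_cong_sets[OF restrict refl]
    using local_param_continuous[OF \<phi>] by (rule borel_measurable_continuous_on_restrict)
  have u_meas: "(\<lambda>x. (x, u x)) \<in> borel_measurable borel"
    by (intro borel_measurable_continuous_onI continuous_intros u)
  have \<phi>_eq: "\<phi> w = (f w, u (f w))" if "w \<in> U" for w
    using graph[of "\<phi> w"] local_param_image_subset[OF \<phi>] that by (auto simp: f_def prod_eq_iff)
  have inj: "inj_on f U"
    using local_param_inj_on[OF \<phi>] \<phi>_eq by (metis inj_on_def)
  have der: "(f has_derivative (\<lambda>v. fst (L w v))) (at w)" if "w \<in> U" for w
    unfolding f_def L_def using local_param_has_derivative[OF \<phi> that] by (rule has_derivative_fst)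
  have fU: "open (f ` U)"
    by (intro invariance_of_domain U inj)
      (auto simp: f_def intro!: continuous_intros local_param_continuous[OF \<phi>])
  have "emeasure (patch_measure U \<phi>) A \<le> emeasure (distr lborel borel (\<lambda>x. (x, u x))) A"
    if A: "A \<in> sets borel" for A
  proof -
    let ?S = "\<phi> -` A \<inter> U"
    have "?S \<in> sets (restrict_space borel U)"
      using measurable_sets[OF \<phi>_meas A] by (simp add: space_restrict_space sets_restrict_space)
    then have S: "?S \<in> sets borel"
      using U by (subst (asm) sets_restrict_space_iff) auto
    \<comment> \<open>Over the graph, membership in \<open>A\<close> can be read off the projected
      point; this exhibits the projected set as Borel.\<close>
    have fS: "f ` ?S = (\<lambda>x. (x, u x)) -` A \<inter> f ` U"
      using \<phi>_eq by (auto simp: image_iff) 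
    have "(\<lambda>x. (x, u x)) -` A \<in> sets borel"
      using measurable_sets[OF u_meas A] by simp
    then have fS_meas: "f ` ?S \<in> sets borel"
      unfolding fS using fU by simp
    have "continuous_on U (\<lambda>w. det (matrix (\<lambda>v. fst (L w v))))"
      by (intro continuous_on_det)
        (simp add: matrix_def L_def, intro continuous_intros local_param_continuous_derivative[OF \<phi>])
    then have "(\<lambda>w. det (matrix (\<lambda>v. fst (L w v)))) \<in> borel_measurable (restrict_space borel U)"
      by (rule borel_measurable_continuous_on_restrict)
    then have "(\<lambda>w. indicator U w *\<^sub>R det (matrix (\<lambda>v. fst (L w v)))) \<in> borel_measurable borel"
      using U by (subst (asm) borel_measurable_restrict_space_iff) auto
    then have "(\<lambda>w. indicator ?S w * (indicator U w *\<^sub>R det (matrix (\<lambda>v. fst (L w v))))) \<in> borel_measurable borel"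
      using S by (intro borel_measurable_times borel_measurable_indicator)
    then have meas: "(\<lambda>w. indicator ?S w * det (matrix (\<lambda>v. fst (L w v)))) \<in> borel_measurable borel"
      by (rule back_subst[where P = "\<lambda>h. h \<in> borel_measurable borel"]) (auto simp: indicator_def)
    have "emeasure (patch_measure U \<phi>) A
        = (\<integral>\<^sup>+w. ennreal (sqrt (det (induced_metric \<phi> w))) * indicator ?S w \<partial>restrict_space lborel U)"
      unfolding patch_measure_def using g \<phi>_meas A measurable_sets[OF \<phi>_meas A]
      by (simp add: emeasure_distr emeasure_density space_restrict_space)
    also have "\<dots> = (\<integral>\<^sup>+w. ennreal (sqrt (det (induced_metric \<phi> w))) * indicator ?S w * indicator U w \<partial>lborel)"
      using U by (subst nn_integral_restrict_space) auto
    also have "\<dots> \<le> (\<integral>\<^sup>+w\<in>?S. ennreal \<bar>det (matrix (\<lambda>v. fst (L w v)))\<bar> \<partial>lborel)"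
      using sqrt_det_induced_metric_le[OF M \<phi>]
      by (intro nn_integral_mono) (auto simp: L_def indicator_def intro!: ennreal_leI)
    also have "\<dots> \<le> emeasure lborel (f ` ?S)"
      by (rule nn_integral_abs_det_le[OF S fS_meas _ _ meas])
        (auto intro: has_derivative_at_withinI der inj_on_subset[OF inj])
    also have "\<dots> \<le> emeasure lborel ((\<lambda>x. (x, u x)) -` A)"
      using measurable_sets[OF u_meas A] by (intro emeasure_mono) (auto simp: fS)
    also have "\<dots> = emeasure (distr lborel borel (\<lambda>x. (x, u x))) A"
      using u_meas A by (simp add: emeasure_distr)
    finally show ?thesis .
  qed
  \<comment> \<open>Both measures live on the Borel sets, so the lattice order on measures is the
    setwise comparison just proved.\<close>
  then show ?thesis
    by (subst le_measure) (simp_all add: patch_measure_def)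
qed

text \<open>A common upper bound of the patch measures bounds their supremum. A point of
  \<open>M\<close> provides at least one patch, from which the supremum inherits the Borel
  sets.\<close>

lemma volume_measure_le:
  fixes M :: "('n::finite, 'm::finite) pseudo_euclidean set"
  assumes sub: "submanifold M" and M: "spacelike M" "M \<noteq> {}"
    and graph: "\<And>p. p \<in> M \<Longrightarrow> snd p = u (fst p)" and u: "continuous_on UNIV u"
  shows "volume_measure M \<le> distr lborel borel (\<lambda>x. (x, u x))" and "sets (volume_measure M) = sets borel"
proof -
  show "volume_measure M \<le> distr lborel borel (\<lambda>x. (x, u x))"
    unfolding volume_measure_def using patch_measure_le[OF M(1) _ graph u] by (intro SUP_least) auto
  have "{(U, \<phi>). local_param M U \<phi>} \<noteq> {}"
    using sub M(2) unfolding submanifold_def by blast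
  then show "sets (volume_measure M) = sets borel"
    unfolding volume_measure_def by (intro sets_SUP) (auto simp: patch_measure_def)
qed


subsection \<open>Finiteness\<close>

text \<open>One term of the exponential series, all of whose terms are nonnegative.\<close>

lemma power_le_fact_mult_exp:
  assumes "0 \<le> (x::real)"
  shows "x ^ n \<le> fact n * exp x"
proof -
  have "x ^ n /\<^sub>R fact n \<le> exp x"
    using sum_le_suminf[OF summable_exp_generic[of x], of "{n}"] assms by (simp add: exp_def)
  then show ?thesis
    by (simp add: field_simps)
qed

text \<open>On the shell where \<open>norm x\<close> has integer part \<open>k\<close> the integrand
  is at most \<open>exp (- (c * k))\<close>. Half of this decay absorbs the polynomial growth of
  ball volumes; the other half leaves a geometric series.\<close>

lemma nn_integral_exp_norm_finite:
  assumes "0 < c"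
  shows "(\<integral>\<^sup>+x. ennreal (exp (- c * norm (x :: 'a::euclidean_space))) \<partial>lborel) < \<infinity>"
proof -
  let ?n = "DIM('a)" and ?q = "\<lambda>k. exp (- (c * real k))"
  \<comment> \<open>Ball volume times the constants in the bound of \<open>(k + 1) ^ ?n\<close> by a
    multiple of \<open>exp (c / 2 * (k + 1))\<close>; the factor \<open>exp (c / 2)\<close> comes
    from the shift between \<open>k + 1\<close> and \<open>k\<close>.\<close>
  define C where "C = unit_ball_vol ?n * (fact ?n * (2 / c) ^ ?n * exp (c / 2))"
  have C: "0 \<le> C"
    using assms by (simp add: C_def)
  have single: "f k \<le> (\<Sum>k. f k)" for f :: "nat \<Rightarrow> ennreal" and k
    using sum_le_suminf[OF summableI, of "{k}" f] by simp
  have pt: "ennreal (exp (- c * norm x)) \<le> (\<Sum>k. ennreal (?q k) * indicator (ball 0 (real k + 1)) x)" for x :: 'a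
  proof -
    define k where "k = nat \<lfloor>norm x\<rfloor>"
    have k: "real k \<le> norm x" "norm x < real k + 1"
      by (auto simp: k_def)
    have "ennreal (exp (- c * norm x)) \<le> ennreal (?q k) * indicator (ball 0 (real k + 1)) x"
      using k assms by (auto intro!: ennreal_leI)
    also have "\<dots> \<le> (\<Sum>k. ennreal (?q k) * indicator (ball 0 (real k + 1)) x)"
      by (rule single)
    finally show ?thesis .
  qed
  have summand: "ennreal (?q k) * emeasure lborel (ball (0 :: 'a) (real k + 1)) \<le> ennreal (C * exp (- (c / 2)) ^ k)" for k
  proof -
    have "(c / 2 * (real k + 1)) ^ ?n \<le> fact ?n * exp (c / 2 * (real k + 1))"
      using assms by (intro power_le_fact_mult_exp) simp
    then have "(2 / c) ^ ?n * (c / 2 * (real k + 1)) ^ ?n \<le> (2 / c) ^ ?n * (fact ?n * exp (c / 2 * (real k + 1)))"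
      using assms by (intro mult_left_mono) auto
    also have "(2 / c) ^ ?n * (c / 2 * (real k + 1)) ^ ?n = (2 / c * (c / 2 * (real k + 1))) ^ ?n"
      by (rule power_mult_distrib[symmetric])
    also have "2 / c * (c / 2 * (real k + 1)) = real k + 1"
      using assms by simp
    finally have "?q k * (unit_ball_vol ?n * (real k + 1) ^ ?n)
        \<le> ?q k * (unit_ball_vol ?n * ((2 / c) ^ ?n * (fact ?n * exp (c / 2 * (real k + 1)))))"
      by (intro mult_left_mono) auto
    also have "\<dots> = C * (?q k * exp (c / 2 * real k))"
      by (simp add: C_def distrib_left exp_add)
    also have "?q k * exp (c / 2 * real k) = exp (- (c / 2)) ^ k"
      by (simp flip: exp_add exp_of_nat_mult)
    finally show ?thesis
      by (simp add: emeasure_ball ennreal_leI flip: ennreal_mult')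
  qed
  have "exp (- (c / 2)) < 1"
    using assms by simp
  then have summ: "summable (\<lambda>k. C * exp (- (c / 2)) ^ k)"
    by (intro summable_mult summable_geometric) simp
  have "(\<integral>\<^sup>+x. ennreal (exp (- c * norm (x :: 'a))) \<partial>lborel)
      \<le> (\<integral>\<^sup>+x. (\<Sum>k. ennreal (?q k) * indicator (ball (0 :: 'a) (real k + 1)) x) \<partial>lborel)"
    by (intro nn_integral_mono pt)
  also have "\<dots> = (\<Sum>k. ennreal (?q k) * emeasure lborel (ball (0 :: 'a) (real k + 1)))"
    by (subst nn_integral_suminf)
      (auto intro!: borel_measurable_times_ennreal borel_measurable_indicator simp: nn_integral_cmult_indicator)
  also have "\<dots> \<le> (\<Sum>k. ennreal (C * exp (- (c / 2)) ^ k))"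
    by (intro suminf_le summand summableI)
  also have "\<dots> = ennreal (\<Sum>k. C * exp (- (c / 2)) ^ k)"
    using C summ by (intro suminf_ennreal2) auto
  also have "\<dots> < \<infinity>"
    by simp
  finally show ?thesis .
qed

text \<open>The constant is the smallest gap \<open>norm x - norm (u x)\<close> on the unit sphere,
  positive by compactness. Subtracting 1 makes the left side nonpositive in the unit ball, so one
  bound serves all \<open>x\<close>.\<close>

lemma pseudo_dist_graph_ge:
  fixes u :: "real^'n \<Rightarrow> real^'m"
  assumes u: "contracting_section M UNIV u" "u 0 = 0"
  obtains c where "0 < c" "\<And>x. c * (norm x - 1) \<le> pseudo_dist (x, u x)"
proof -
  have le: "norm (u y - u x) \<le> norm (y - x)" for x y
    using contracting_section_norm_less[OF u(1) convex_UNIV, of x y] by (cases "x = y") auto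
  have "continuous_on (sphere 0 1) (\<lambda>x. norm (u x))"
    by (intro continuous_intros continuous_on_subset[OF contracting_section_continuous_on[OF u(1)]]) simp
  moreover have "sphere (0 :: real^'n) 1 \<noteq> {}"
    by simp
  ultimately obtain a where a: "norm a = 1" "\<And>x. norm x = 1 \<Longrightarrow> norm (u x) \<le> norm (u a)"
    using continuous_attains_sup[OF compact_sphere, of 0 1 "\<lambda>x. norm (u x)"] by auto
  define c where "c = 1 - norm (u a)"
  have "a \<noteq> 0"
    using a(1) by auto
  then have "norm (u a) < 1"
    using contracting_section_norm_less[OF u(1) convex_UNIV, of 0 a] a(1) u(2) by auto
  then have c: "0 < c"
    by (simp add: c_def)
  have "c * (norm x - 1) \<le> pseudo_dist (x, u x)" for x
  proof -
    have pd: "pseudo_dist (x, u x) = (norm x - norm (u x)) * (norm x + norm (u x))"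
      by (simp add: pseudo_dist_def pinner_def algebra_simps power2_eq_square flip: power2_norm_eq_inner)
    have ux: "norm (u x) \<le> norm x"
      using le[of x 0] u(2) by simp
    show ?thesis
    proof (cases "norm x \<le> 1")
      case True
      then have "c * (norm x - 1) \<le> 0"
        using c by (simp add: mult_nonneg_nonpos)
      also have "0 \<le> pseudo_dist (x, u x)"
        unfolding pd using ux by simp
      finally show ?thesis .
    next
      case False
      define e where "e = (1 / norm x) *\<^sub>R x"
      have e: "norm e = 1"
        using False by (auto simp: e_def)
      have "x - e = (1 - 1 / norm x) *\<^sub>R x"
        by (simp add: e_def algebra_simps)
      then have "norm (x - e) = \<bar>1 - 1 / norm x\<bar> * norm x"
        by (metis norm_scaleR)
      also have "\<bar>1 - 1 / norm x\<bar> = 1 - 1 / norm x"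
        using False by (intro abs_of_nonneg) (simp add: divide_le_eq)
      also have "(1 - 1 / norm x) * norm x = norm x - 1"
        using False by (auto simp: left_diff_distrib)
      finally have "norm (x - e) = norm x - 1" .
      \<comment> \<open>From the radial projection \<open>e\<close> out to \<open>x\<close>,
        \<open>norm (u x)\<close> grows by at most \<open>norm x - 1\<close>, so the gap at
        \<open>x\<close> is no smaller than at \<open>e\<close>.\<close>
      then have "norm (u x) \<le> norm (u e) + (norm x - 1)"
        using le[of x e] norm_triangle_ineq2[of "u x" "u e"] by linarith
      also have "norm (u e) \<le> 1 - c"
        using a(2)[OF e] by (simp add: c_def)
      finally have "c \<le> norm x - norm (u x)"
        by simp
      then have "c * (norm x - 1) \<le> (norm x - norm (u x)) * (norm x + norm (u x))"
        using c False norm_ge_zero[of "u x"] by (intro mult_mono) linarith+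
      then show ?thesis
        by (simp add: pd)
    qed
  qed
  with c show ?thesis ..
qed

section \<open>Domination of the weighted integral\<close>

lemma borel_measurable_pseudo_dist: "pseudo_dist \<in> borel_measurable borel"
  unfolding pseudo_dist_def pinner_def
  by (intro borel_measurable_continuous_onI continuous_intros)

lemma spacelike_exp_integral_finite:
  fixes M :: "('n::finite, 'm::finite) pseudo_euclidean set"
  assumes M: "submanifold M" "spacelike M" "connected M" "0 \<in> M" "closed M" and \<alpha>: "0 < \<alpha>"
  shows "(\<integral>\<^sup>+p\<in>M. ennreal (exp (- \<alpha> * pseudo_dist p)) \<partial>volume_measure M) < \<infinity>"
    and "sets (volume_measure M) = sets borel"
proof -
  obtain u where u: "contracting_section M UNIV u" "u 0 = 0" and graph: "M = range (\<lambda>x. (x, u x))"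
    using closed_connected_graph[OF spacelike_locally_contracting_graph[OF M(1,2)] M(5,3,4)] by blast
  have snd: "snd p = u (fst p)" if "p \<in> M" for p
    using that graph by auto
  have cont: "continuous_on UNIV u"
    using u(1) by (rule contracting_section_continuous_on)
  have "M \<noteq> {}"
    using M(4) by blast
  note vol = volume_measure_le[OF M(1,2) this snd cont]
  show sets: "sets (volume_measure M) = sets borel"
    by (rule vol(2))
  obtain c where c: "0 < c" "\<And>x. c * (norm x - 1) \<le> pseudo_dist (x, u x)"
    using pseudo_dist_graph_ge[OF u] by blast
  let ?h = "\<lambda>p. ennreal (exp (- \<alpha> * pseudo_dist p)) * indicator M p"
  have h: "?h \<in> borel_measurable borel"
    using borel_closed[OF M(5)] borel_measurable_pseudo_dist by measurable
  have graph_meas: "(\<lambda>x. (x, u x)) \<in> borel_measurable borel"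
    by (intro borel_measurable_continuous_onI continuous_intros cont)
  have "(\<integral>\<^sup>+p\<in>M. ennreal (exp (- \<alpha> * pseudo_dist p)) \<partial>volume_measure M)
      \<le> (\<integral>\<^sup>+p. ?h p \<partial>distr lborel borel (\<lambda>x. (x, u x)))"
    by (intro nn_integral_mono_measure vol(1)) (simp add: sets)
  also have "\<dots> = (\<integral>\<^sup>+x. ?h (x, u x) \<partial>lborel)"
    using graph_meas h by (subst nn_integral_distr) simp_all
  \<comment> \<open>The shift by 1 in the lower bound for the pseudo-distance becomes the constant
    factor \<open>exp (\<alpha> * c)\<close>; the indicator is at most 1.\<close>
  also have "\<dots> \<le> (\<integral>\<^sup>+x. ennreal (exp (\<alpha> * c)) * ennreal (exp (- (\<alpha> * c) * norm (x :: real^'n))) \<partial>lborel)"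
  proof (intro nn_integral_mono)
    fix x :: "real^'n"
    have "\<alpha> * (c * (norm x - 1)) \<le> \<alpha> * pseudo_dist (x, u x)"
      using c(2) \<alpha> by (intro mult_left_mono) auto
    then have "exp (- \<alpha> * pseudo_dist (x, u x)) \<le> exp (\<alpha> * c + - (\<alpha> * c) * norm x)"
      by (simp add: algebra_simps)
    also have "\<dots> = exp (\<alpha> * c) * exp (- (\<alpha> * c) * norm x)"
      by (rule exp_add)
    finally have "exp (- \<alpha> * pseudo_dist (x, u x)) \<le> exp (\<alpha> * c) * exp (- (\<alpha> * c) * norm x)" .
    then show "?h (x, u x) \<le> ennreal (exp (\<alpha> * c)) * ennreal (exp (- (\<alpha> * c) * norm x))"
      by (simp add: indicator_def ennreal_leI flip: ennreal_mult')
  qed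
  also have "\<dots> = ennreal (exp (\<alpha> * c)) * (\<integral>\<^sup>+x. ennreal (exp (- (\<alpha> * c) * norm (x :: real^'n))) \<partial>lborel)"
    by (rule nn_integral_cmult) measurable
  also have "\<dots> < \<infinity>"
    using nn_integral_exp_norm_finite[where 'a = "real^'n", of "\<alpha> * c"] \<alpha> c(1)
    by (simp add: ennreal_mult_less_top)
  finally show "(\<integral>\<^sup>+p\<in>M. ennreal (exp (- \<alpha> * pseudo_dist p)) \<partial>volume_measure M) < \<infinity>" .
qed

theorem theorem4p1:
  fixes M :: "('n::finite, 'm::finite) pseudo_euclidean set"
  assumes "spacelike_self_shrinker M"
    and "connected M"
    and "0 \<in> M"
    and "closed M"
  shows "(\<forall>\<alpha>::real. \<alpha> > 0 \<longrightarrow>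
            (\<integral>\<^sup>+p\<in>M. ennreal (exp (- \<alpha> * pseudo_dist p)) \<partial>volume_measure M) < \<infinity>)
       \<and> weighted_volume M < \<infinity>
       \<and> (\<integral>\<^sup>+p\<in>M. ennreal (exp (- pseudo_dist p / 4)) \<partial>volume_measure M) < \<infinity>"
proof -
  have M: "submanifold M" "spacelike M"
    using assms(1) by (auto simp: spacelike_self_shrinker_def)
  note finite = spacelike_exp_integral_finite[OF M assms(2-4)]
  have quarter: "(\<integral>\<^sup>+p\<in>M. ennreal (exp (- pseudo_dist p / 4)) \<partial>volume_measure M) < \<infinity>"
    using finite(1)[of "1 / 4"] by simp
  have sets: "sets (volume_measure M) = sets borel"
    \<comment> \<open>\<open>1\<close> is a default positive exponent, discharging the premise
      \<open>0 < \<alpha>\<close>.\<close>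
    by (rule finite(2)[of 1]) simp
  have "(\<lambda>p. ennreal (exp (- pseudo_dist p / 4))) \<in> borel_measurable (volume_measure M)"
    unfolding measurable_cong_sets[OF sets refl] using borel_measurable_pseudo_dist by measurable
  \<comment> \<open>Closedness makes \<open>M\<close> a Borel set, so its measure under the density
    is the integral over \<open>M\<close>.\<close>
  then have "weighted_volume M = (\<integral>\<^sup>+p\<in>M. ennreal (exp (- pseudo_dist p / 4)) \<partial>volume_measure M)"
    unfolding weighted_volume_def using assms(4) sets by (intro emeasure_density) auto
  with quarter finite(1) show ?thesis
    by simp
qed

end
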